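(* Let $n\ge 1$. There exists a decomposition of the state space $\mathbb{R}^{2n}$ into pairwise disjoint open $2k$-manifolds (cells) $\mathcal{M}_{k,\sigma}$, $1\le k\le n$, $\sigma\in S^k_n$, together with $\mathcal{M}_{0,I}=\{\mathbf{0}\}$, i.e. $$\mathbb{R}^{2n}=\bigsqcup_{k=0}^{n}\ \bigsqcup_{\sigma\in S^k_n}\mathcal{M}_{k,\sigma},$$ which is invariant under all Eulerian flows. For each $k=1,\dots,n$ there are $\binom{n}{k}$ cells of dimension $2k$, corresponding to the permutations $\sigma\in S^k_n$, while there are no cells of odd dimension. Each $\mathcal{M}_{k,\sigma}$ is diffeomorphic to the product $(\mathbb{S}^1\times\mathbb{R}^+)^k$ of $k$ cylinders.
   Context: Points of $\mathbb{R}^{2n}$ are $\mathbf{x}=(x_1,y_1,\dots,x_n,y_n)$ and $\mathbb{R}^+=(0,\infty)$. $S_n$ is the group of permutations of $\{1,\dots,n\}$ and $S^k_n=\{\sigma\in S_n:\ \sigma(i)<\sigma(j)\text{ for } i<j\le k \text{ and for } k<i<j\le n\}$; $I$ is the identity permutation, so $S^0_n=S^n_n=\{I\}$. The cells are denoted $\mathcal{M}_{k,\sigma}=\{\mathbf{x}\in\mathbb{R}^{2n}:\ (x_{\sigma(i)},y_{\sigma(i)})\ne(0,0)\text{ for } i\le k,\ (x_{\sigma(i)},y_{\sigma(i)})=(0,0)\text{ for } i>k\}$; here an "open cell" is a manifold without boundary. An Eulerian flow is the (formal) flow of a vector field $$\Theta+\sum_{i=1}^n f_i\,\Theta^i_{\mathbf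 0}+g\,E_{\mathbf 0},\quad \Theta=\sum_{i=1}^n\omega_i\Theta^i_{\mathbf 0},\quad \Theta^i_{\mathbf 0}=-y_i\frac{\partial}{\partial x_i}+x_i\frac{\partial}{\partial y_i},\quad E_{\mathbf 0}=\sum_{i=1}^n x_i\frac{\partial}{\partial x_i}+y_i\frac{\partial}{\partial y_i},$$ where $f_i,g\in\mathbb{R}[[\mathbf{x}]]$, $f_i(0)=g(0)=0$, $\prod_i\omega_i\neq0$ and $\omega_i/\omega_j\notin\mathbb{Q}$ for $1\le i<j\le n$. A set is flow-invariant if trajectories starting in it remain in it; the decomposition is flow-invariant if each of its cells is. *)

theory Defs
  imports
    "HOL-Analysis.Analysis"
    "HOL-Combinatorics.Permutations"
    "HOL-Computational_Algebra.Formal_Power_Series"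
begin

text \<open>
  The dimensions \<open>2 n\<close> and \<open>2 k\<close> vary inside the statement, so \<open>\<real>\<^sup>d\<close> is the library's
  \<^term>\<open>Euclidean_space d\<close>, the space of all \<open>x :: nat \<Rightarrow> real\<close> with \<open>x l = 0\<close> for \<open>l \<ge> d\<close>.
\<close>

section \<open>Smooth maps, diffeomorphisms and submanifolds\<close>

definition partial_deriv :: "nat \<Rightarrow> ((nat \<Rightarrow> real) \<Rightarrow> real) \<Rightarrow> (nat \<Rightarrow> real) \<Rightarrow> real" where
  "partial_deriv i f x = deriv (\<lambda>t. f (x(i := t))) (x i)"

definition iter_partial :: "nat list \<Rightarrow> ((nat \<Rightarrow> real) \<Rightarrow> real) \<Rightarrow> (nat \<Rightarrow> real) \<Rightarrow> real" where
  "iter_partial is f = foldr partial_deriv is f"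

text \<open>\<open>C\<^sup>\<infinity>\<close> on an open set: all iterated partial derivatives exist and are continuous.\<close>

definition smooth_on :: "nat \<Rightarrow> (nat \<Rightarrow> real) set \<Rightarrow> ((nat \<Rightarrow> real) \<Rightarrow> real) \<Rightarrow> bool" where
  "smooth_on d U f \<longleftrightarrow> openin (Euclidean_space d) U \<and>
     (\<forall>is \<in> lists {..<d}.
        continuous_map (subtopology (Euclidean_space d) U) euclideanreal (iter_partial is f) \<and>
        (\<forall>x\<in>U. \<forall>i<d. (\<lambda>t. iter_partial is f (x(i := t))) differentiable (at (x i))))"

text \<open>
  Smoothness of a map between arbitrary subsets \<open>A \<subseteq> \<real>\<^sup>a\<close> and \<open>B \<subseteq> \<real>\<^sup>b\<close> means, as usual, that
  it extends to a smooth map on a neighbourhood in \<open>\<real>\<^sup>a\<close> of each point of \<open>A\<close>.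
\<close>

definition smooth_map ::
    "nat \<Rightarrow> (nat \<Rightarrow> real) set \<Rightarrow> nat \<Rightarrow> (nat \<Rightarrow> real) set \<Rightarrow> ((nat \<Rightarrow> real) \<Rightarrow> nat \<Rightarrow> real) \<Rightarrow> bool" where
  "smooth_map a A b B f \<longleftrightarrow>
     A \<subseteq> topspace (Euclidean_space a) \<and> B \<subseteq> topspace (Euclidean_space b) \<and> f ` A \<subseteq> B \<and>
     (\<forall>x\<in>A. \<exists>U F. x \<in> U \<and> (\<forall>j<b. smooth_on a U (\<lambda>z. F z j)) \<and> openin (Euclidean_space a) U \<and>
        (\<forall>z \<in> U \<inter> A. \<forall>j<b. F z j = f z j))"

definition diffeomorphic :: "nat \<Rightarrow> (nat \<Rightarrow> real) set \<Rightarrow> nat \<Rightarrow> (nat \<Rightarrow> real) set \<Rightarrow> bool" where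
  "diffeomorphic a A b B \<longleftrightarrow>
     (\<exists>f g. smooth_map a A b B f \<and> smooth_map b B a A g \<and>
        (\<forall>x\<in>A. g (f x) = x) \<and> (\<forall>y\<in>B. f (g y) = y))"

text \<open>\<open>M\<close> is a \<open>d\<close>-dimensional smooth submanifold of \<open>\<real>\<^sup>N\<close> without boundary.\<close>

definition manifold :: "nat \<Rightarrow> nat \<Rightarrow> (nat \<Rightarrow> real) set \<Rightarrow> bool" where
  "manifold N d M \<longleftrightarrow> M \<subseteq> topspace (Euclidean_space N) \<and>
     (\<forall>x\<in>M. \<exists>W V. x \<in> W \<and> openin (subtopology (Euclidean_space N) M) W \<and>
        openin (Euclidean_space d) V \<and> diffeomorphic N W d V)"

text \<open>
  \<open>(S\<^sup>1 \<times> \<real>\<^sup>+)\<^sup>k\<close> as a subset of \<open>(\<real>\<^sup>2 \<times> \<real>)\<^sup>k = \<real>\<^bsup>3k\<^esup>\<close>: the \<open>i\<close>-th factor has coordinates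
  \<open>3i, 3i+1\<close> (on the circle) and \<open>3i+2\<close> (on the half-line).
\<close>

definition cylinders :: "nat \<Rightarrow> (nat \<Rightarrow> real) set" where
  "cylinders k = {z \<in> topspace (Euclidean_space (3*k)).
     \<forall>i<k. (z (3*i))\<^sup>2 + (z (3*i+1))\<^sup>2 = 1 \<and> 0 < z (3*i+2)}"

section \<open>The cells\<close>

definition perms :: "nat \<Rightarrow> nat \<Rightarrow> (nat \<Rightarrow> nat) set" where
  "perms n k = {\<sigma>. \<sigma> permutes {1..n} \<and>
     (\<forall>i j. 1 \<le> i \<and> i < j \<and> j \<le> k \<longrightarrow> \<sigma> i < \<sigma> j) \<and>
     (\<forall>i j. k < i \<and> i < j \<and> j \<le> n \<longrightarrow> \<sigma> i < \<sigma> j)}"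

text \<open>
  A point is \<open>(x\<^sub>1, y\<^sub>1, \<dots>, x\<^sub>n, y\<^sub>n)\<close> with coordinates numbered from \<open>0\<close>, so for \<open>1 \<le> i \<le> n\<close> the
  coordinates \<open>x\<^sub>i\<close> and \<open>y\<^sub>i\<close> have numbers \<open>2i-2\<close> and \<open>2i-1\<close>.  Cells and vector fields are
  polymorphic in the coefficient ring: it is \<open>\<real>\<close> for actual points and \<open>\<real>[[s]]\<close> for formal ones.
\<close>

definition xc :: "nat \<Rightarrow> (nat \<Rightarrow> 'a) \<Rightarrow> 'a" where "xc i p = p (2*i - 2)"
definition yc :: "nat \<Rightarrow> (nat \<Rightarrow> 'a) \<Rightarrow> 'a" where "yc i p = p (2*i - 1)"

definition cell :: "nat \<Rightarrow> nat \<Rightarrow> (nat \<Rightarrow> nat) \<Rightarrow> (nat \<Rightarrow> 'a::zero) set" where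
  "cell n k \<sigma> = {p. (\<forall>l\<ge>2*n. p l = 0) \<and>
     (\<forall>i\<in>{1..k}. (xc (\<sigma> i) p, yc (\<sigma> i) p) \<noteq> (0, 0)) \<and>
     (\<forall>i\<in>{k<..n}. (xc (\<sigma> i) p, yc (\<sigma> i) p) = (0, 0))}"

section \<open>Eulerian vector fields\<close>

definition rot_field :: "nat \<Rightarrow> (nat \<Rightarrow> 'a::comm_ring_1) \<Rightarrow> nat \<Rightarrow> 'a" where
  "rot_field i p = (\<lambda>l. if l = 2*i - 2 then - yc i p else if l = 2*i - 1 then xc i p else 0)"

definition euler_field :: "nat \<Rightarrow> (nat \<Rightarrow> 'a::comm_ring_1) \<Rightarrow> nat \<Rightarrow> 'a" where
  "euler_field n p = (\<lambda>l. if l < 2*n then p l else 0)"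

text \<open>The value at \<open>p\<close>; \<open>f i\<close> and \<open>g\<close> stand for the values of the coefficients at \<open>p\<close>.\<close>

definition eulerian_field ::
    "nat \<Rightarrow> (nat \<Rightarrow> 'a::comm_ring_1) \<Rightarrow> (nat \<Rightarrow> 'a) \<Rightarrow> 'a \<Rightarrow> (nat \<Rightarrow> 'a) \<Rightarrow> nat \<Rightarrow> 'a" where
  "eulerian_field n \<omega> f g p = (\<lambda>l.
     (\<Sum>i=1..n. \<omega> i * rot_field i p l) + (\<Sum>i=1..n. f i * rot_field i p l) + g * euler_field n p l)"

text \<open>
  A formal power series in \<open>d\<close> variables is its coefficient function
  \<open>(nat \<Rightarrow> nat) \<Rightarrow> real\<close>, of which only the values on multi-indices supported in \<open>{..<d}\<close> matter.
\<close>

type_synonym mseries = "(nat \<Rightarrow> nat) \<Rightarrow> real"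

definition multi_indices :: "nat \<Rightarrow> (nat \<Rightarrow> nat) set" where
  "multi_indices d = {\<alpha>. \<forall>l\<ge>d. \<alpha> l = 0}"

definition eulerian_data ::
    "nat \<Rightarrow> (nat \<Rightarrow> real) \<Rightarrow> (nat \<Rightarrow> mseries) \<Rightarrow> mseries \<Rightarrow> bool" where
  "eulerian_data n \<omega> f g \<longleftrightarrow>
     (\<forall>i\<in>{1..n}. f i (\<lambda>_. 0) = 0) \<and> g (\<lambda>_. 0) = 0 \<and>
     (\<Prod>i=1..n. \<omega> i) \<noteq> 0 \<and>
     (\<forall>i j. 1 \<le> i \<and> i < j \<and> j \<le> n \<longrightarrow> \<omega> i / \<omega> j \<notin> \<rat>)"

section \<open>Invariance under Eulerian flows\<close>

text \<open>
  The coefficients of an Eulerian vector field are formal power series, which need not converge.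
  Its flow therefore has two meanings, and invariance is defined for both of them.

  (1) Trajectories in the state space.  The formal coefficients are realized by smooth functions
  on a neighbourhood \<open>U\<close> of the origin with these Taylor series (if the series converge, their
  sums are such functions; by Borel's lemma every formal series has a realization).
\<close>

definition has_taylor_series ::
    "nat \<Rightarrow> (nat \<Rightarrow> real) set \<Rightarrow> ((nat \<Rightarrow> real) \<Rightarrow> real) \<Rightarrow> mseries \<Rightarrow> bool" where
  "has_taylor_series d U F a \<longleftrightarrow> smooth_on d U F \<and> (\<lambda>_. 0) \<in> U \<and>
     (\<forall>\<alpha>\<in>multi_indices d.
        iter_partial (concat (map (\<lambda>l. replicate (\<alpha> l) l) [0..<d])) F (\<lambda>_. 0)
          = (\<Prod>l<d. fact (\<alpha> l)) * a \<alpha>)"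

definition eulerian_trajectory ::
    "nat \<Rightarrow> (nat \<Rightarrow> real) \<Rightarrow> (nat \<Rightarrow> (nat \<Rightarrow> real) \<Rightarrow> real) \<Rightarrow> ((nat \<Rightarrow> real) \<Rightarrow> real) \<Rightarrow>
     (nat \<Rightarrow> real) set \<Rightarrow> real set \<Rightarrow> (real \<Rightarrow> nat \<Rightarrow> real) \<Rightarrow> bool" where
  "eulerian_trajectory n \<omega> F G U T \<gamma> \<longleftrightarrow>
     is_interval T \<and> 0 \<in> T \<and>
     (\<forall>t\<in>T. \<gamma> t \<in> U \<and>
       (\<forall>l<2*n. ((\<lambda>t. \<gamma> t l) has_real_derivative
          eulerian_field n \<omega> (\<lambda>i. F i (\<gamma> t)) (G (\<gamma> t)) (\<gamma> t) l) (at t within T)))"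

definition eulerian_flow_invariant :: "nat \<Rightarrow> (nat \<Rightarrow> real) set \<Rightarrow> bool" where
  "eulerian_flow_invariant n M \<longleftrightarrow>
     (\<forall>\<omega> f g U F G T \<gamma>.
        eulerian_data n \<omega> f g \<and> openin (Euclidean_space (2*n)) U \<and>
        (\<forall>i\<in>{1..n}. has_taylor_series (2*n) U (F i) (f i)) \<and> has_taylor_series (2*n) U G g \<and>
        eulerian_trajectory n \<omega> F G U T \<gamma> \<and> \<gamma> 0 \<in> M
        \<longrightarrow> (\<forall>t\<in>T. \<gamma> t \<in> M))"

text \<open>
  (2) The formal flow.  It acts on the formal points at the origin, that is, on points with
  coordinates in \<open>s\<real>[[s]]\<close>, where every formal power series can be evaluated: the coefficient of
  \<open>s\<^sup>m\<close> in the value only involves monomials of degree at most \<open>m\<close>.  A formal trajectory solves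
  the differential equation coefficientwise in \<open>s\<close>.
\<close>

definition mseries_eval :: "nat \<Rightarrow> mseries \<Rightarrow> (nat \<Rightarrow> real fps) \<Rightarrow> real fps" where
  "mseries_eval d a z = Abs_fps (\<lambda>m.
     \<Sum>\<alpha> \<in> {\<alpha> \<in> multi_indices d. (\<Sum>l<d. \<alpha> l) \<le> m}. a \<alpha> * fps_nth (\<Prod>l<d. z l ^ \<alpha> l) m)"

definition formal_eulerian_trajectory ::
    "nat \<Rightarrow> (nat \<Rightarrow> real) \<Rightarrow> (nat \<Rightarrow> mseries) \<Rightarrow> mseries \<Rightarrow> (real \<Rightarrow> nat \<Rightarrow> real fps) \<Rightarrow> bool" where
  "formal_eulerian_trajectory n \<omega> f g \<zeta> \<longleftrightarrow>
     (\<forall>t l. fps_nth (\<zeta> t l) 0 = 0) \<and> (\<forall>t. \<forall>l\<ge>2*n. \<zeta> t l = 0) \<and>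
     (\<forall>t. \<forall>l<2*n. \<forall>m. ((\<lambda>t. fps_nth (\<zeta> t l) m) has_real_derivative
        fps_nth (eulerian_field n (\<lambda>i. fps_const (\<omega> i))
          (\<lambda>i. mseries_eval (2*n) (f i) (\<zeta> t)) (mseries_eval (2*n) g (\<zeta> t)) (\<zeta> t) l) m) (at t))"

definition formal_eulerian_flow_invariant :: "nat \<Rightarrow> (nat \<Rightarrow> real fps) set \<Rightarrow> bool" where
  "formal_eulerian_flow_invariant n M \<longleftrightarrow>
     (\<forall>\<omega> f g \<zeta>. eulerian_data n \<omega> f g \<and> formal_eulerian_trajectory n \<omega> f g \<zeta> \<and> \<zeta> 0 \<in> M
        \<longrightarrow> (\<forall>t. \<zeta> t \<in> M))"

end

theory Submission
  imports Defs "HOL-Homology.Invariance_of_Domain"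
begin

text \<open>
  \<open>\<real>\<^bsup>2n\<^esup>\<close> is a product of \<open>n\<close> planes.  Sorting its points by the set \<open>S\<close> of the planes in which
  their component is nonzero partitions it into one piece for each \<open>S \<subseteq> {1..n}\<close>, and these pieces
  are the cells: \<open>\<sigma> \<mapsto> \<sigma> ` {1..k}\<close> is a bijection from \<open>perms n k\<close> to the \<open>k\<close>-element
  subsets, because the two increasing parts of \<open>\<sigma>\<close> enumerate \<open>S\<close> and its complement
  (\<open>cell_eq_stratum\<close>, \<open>perms_bij_subsets\<close>).  This gives disjointness, the covering property and
  the number of cells.

  Invariance holds because the Eulerian fields act in each plane by a rotation and a dilation
  (\<open>eulerian_field_block\<close>), so that a component in a plane is zero either always or never.  For
  trajectories in the state space, the squared radius in a plane solves a scalar linear equation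
  \<open>r' = 2 G r\<close> with continuous \<open>G\<close>.  For the formal flow, an induction on the order in \<open>s\<close>
  shows that the coefficients vanish one order after the other: \<open>f i\<close> and \<open>g\<close> have no constant
  term, and the linear rotation that remains in the lowest order preserves the sum of squares.

  A cell with \<open>k\<close> nonzero components is, up to the order of the coordinates, a product of \<open>k\<close>
  punctured planes.  It is thus diffeomorphic to an open subset of \<open>\<real>\<^bsup>2k\<^esup>\<close>, and to the product of
  cylinders by polar coordinates.  The maps involved are smooth since they belong to a class of
  functions closed under partial derivatives (\<open>elementary_on_smooth_map\<close>).  Finally, Brouwer's
  invariance of domain shows that a cell is a manifold of no other dimension
  (\<open>manifold_cell_iff\<close>); this excludes odd dimensions and identifies the cells of dimension
  \<open>2k\<close>.
\<close>

section \<open>Smooth maps between Euclidean spaces\<close>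

lemma Euclidean_space_eq_top_of_set:
  "Euclidean_space d = top_of_set (topspace (Euclidean_space d))"
  by (simp add: Euclidean_space_def euclidean_product_topology)

lemma subtopology_Euclidean_space:
  assumes "U \<subseteq> topspace (Euclidean_space d)"
  shows "subtopology (Euclidean_space d) U = top_of_set U"
  using assms
  by (simp add: Euclidean_space_def euclidean_product_topology subtopology_subtopology
      topspace_Euclidean_space inf.absorb2)

lemma openin_Euclidean_space_iff:
  "openin (Euclidean_space d) U \<longleftrightarrow> (\<exists>V. open V \<and> U = topspace (Euclidean_space d) \<inter> V)"
  by (simp add: Euclidean_space_def euclidean_product_topology openin_open)

text \<open>
  A partial derivative at a point of \<open>U\<close> only depends on the values of the function in \<open>U\<close>,
  because \<open>U\<close> contains an open piece of each coordinate line through the point.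
\<close>

lemma openin_coordinate_line:
  assumes U: "openin (Euclidean_space d) U" and "x \<in> U" "i < d"
  shows "open {t. x(i := t) \<in> U}"
proof -
  obtain V where V: "open V" "U = topspace (Euclidean_space d) \<inter> V"
    using U unfolding openin_Euclidean_space_iff by blast
  have "continuous_on UNIV (\<lambda>t. x(i := t))"
  proof (rule continuous_on_coordinatewise_then_product)
    show "continuous_on UNIV (\<lambda>t. (x(i := t)) j)" for j
      by (cases "j = i") (auto intro: continuous_intros)
  qed
  then have "open ((\<lambda>t. x(i := t)) -` V)"
    using V(1) by (simp add: open_vimage)
  moreover have "{t. x(i := t) \<in> U} = (\<lambda>t. x(i := t)) -` V"
    using assms V(2) by (auto simp: topspace_Euclidean_space)
  ultimately show ?thesis by simp
qed

text \<open>
  Smoothness involves partial derivatives of every order, so it is not accessible to induction on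
  the order for a single function.  It is for a class of functions that is closed under partial
  differentiation.  The class below is rich enough for the charts of the cells:
  \<open>powr\<close> with exponents \<open>1/2\<close> and \<open>-1/2\<close> provides the radius and its reciprocal, and
  differentiating a power gives a power with another exponent of the same function.
\<close>

inductive_set elementary_on :: "(nat \<Rightarrow> real) set \<Rightarrow> ((nat \<Rightarrow> real) \<Rightarrow> real) set"
  for U :: "(nat \<Rightarrow> real) set" where
  const: "(\<lambda>_. c) \<in> elementary_on U"
| coord: "(\<lambda>x. x i) \<in> elementary_on U"
| add: "f \<in> elementary_on U \<Longrightarrow> g \<in> elementary_on U \<Longrightarrow> (\<lambda>x. f x + g x) \<in> elementary_on U"
| mult: "f \<in> elementary_on U \<Longrightarrow> g \<in> elementary_on U \<Longrightarrow> (\<lambda>x. f x * g x) \<in> elementary_on U"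
| powr: "f \<in> elementary_on U \<Longrightarrow> (\<And>x. x \<in> U \<Longrightarrow> 0 < f x) \<Longrightarrow> (\<lambda>x. f x powr a) \<in> elementary_on U"

lemma elementary_on_if_zero:
  "f \<in> elementary_on U \<Longrightarrow> (\<lambda>x. if P then f x else 0) \<in> elementary_on U"
  by (cases P) (simp_all add: elementary_on.const)

lemma elementary_on_continuous:
  assumes "f \<in> elementary_on U"
  shows "continuous_on U f"
  using assms
proof induction
  case (coord i)
  show ?case
    by (rule continuous_on_subset[OF continuous_on_product_coordinates]) simp
next
  case (powr f a)
  then have "\<forall>x\<in>U. f x \<noteq> 0" by fastforce
  with powr.IH show ?case by (intro continuous_on_powr) auto
qed (auto intro: continuous_intros)

lemma elementary_on_partial:
  assumes "f \<in> elementary_on U"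
  shows "\<exists>h\<in>elementary_on U. \<forall>x\<in>U. ((\<lambda>t. f (x(i := t))) has_real_derivative h x) (at (x i))"
  using assms
proof induction
  case (const c)
  show ?case
    by (rule bexI[OF _ elementary_on.const[of 0]]) auto
next
  case (coord j)
  show ?case
    by (rule bexI[OF _ elementary_on.const[of "if j = i then 1 else 0"]]) auto
next
  case (add f g)
  then obtain f' g' where *: "f' \<in> elementary_on U" "g' \<in> elementary_on U"
    "\<forall>x\<in>U. ((\<lambda>t. f (x(i := t))) has_real_derivative f' x) (at (x i))"
    "\<forall>x\<in>U. ((\<lambda>t. g (x(i := t))) has_real_derivative g' x) (at (x i))"
    by blast
  show ?case
  proof (intro bexI[of _ "\<lambda>x. f' x + g' x"] ballI)
    fix x assume "x \<in> U"
    then show "((\<lambda>t. f (x(i := t)) + g (x(i := t))) has_real_derivative f' x + g' x) (at (x i))"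
      using DERIV_add[OF *(3)[rule_format] *(4)[rule_format], of x x] by simp
  qed (intro elementary_on.add *)
next
  case (mult f g)
  then obtain f' g' where *: "f' \<in> elementary_on U" "g' \<in> elementary_on U"
    "\<forall>x\<in>U. ((\<lambda>t. f (x(i := t))) has_real_derivative f' x) (at (x i))"
    "\<forall>x\<in>U. ((\<lambda>t. g (x(i := t))) has_real_derivative g' x) (at (x i))"
    by blast
  show ?case
  proof (intro bexI[of _ "\<lambda>x. f' x * g x + g' x * f x"] ballI)
    fix x assume "x \<in> U"
    then show "((\<lambda>t. f (x(i := t)) * g (x(i := t))) has_real_derivative
        f' x * g x + g' x * f x) (at (x i))"
      using DERIV_mult[OF *(3)[rule_format] *(4)[rule_format], of x x] by simp
  qed (intro elementary_on.add elementary_on.mult * mult.hyps)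
next
  case (powr f a)
  then obtain f' where *: "f' \<in> elementary_on U"
    "\<forall>x\<in>U. ((\<lambda>t. f (x(i := t))) has_real_derivative f' x) (at (x i))"
    by blast
  show ?case
  proof (intro bexI[of _ "\<lambda>x. a * f x powr (a - 1) * f' x"] ballI)
    fix x assume "x \<in> U"
    then show "((\<lambda>t. f (x(i := t)) powr a) has_real_derivative
        a * f x powr (a - 1) * f' x) (at (x i))"
      using DERIV_fun_powr[OF *(2)[rule_format], of x a] powr.hyps(2)[of x] by simp
  qed (intro elementary_on.mult elementary_on.const elementary_on.powr * powr.hyps)
qed

text \<open>
  Outside \<open>U\<close> the iterated partial derivatives need not have any closed form, hence the
  agreement with an elementary function only on \<open>U\<close>.
\<close>

lemma elementary_on_iter_partial:
  assumes U: "openin (Euclidean_space d) U" and f: "f \<in> elementary_on U"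
    and "is \<in> lists {..<d}"
  shows "\<exists>h\<in>elementary_on U. \<forall>x\<in>U. iter_partial is f x = h x"
  using assms(3)
proof (induction "is")
  case Nil
  then show ?case using f by (auto simp: iter_partial_def)
next
  case (Cons i "is")
  then have i: "i < d" by simp
  from Cons obtain h where h: "h \<in> elementary_on U" "\<forall>x\<in>U. iter_partial is f x = h x"
    by blast
  obtain h' where h': "h' \<in> elementary_on U"
    "\<forall>x\<in>U. ((\<lambda>t. h (x(i := t))) has_real_derivative h' x) (at (x i))"
    using elementary_on_partial[OF h(1)] by blast
  have "iter_partial (i # is) f x = h' x" if x: "x \<in> U" for x
  proof -
    have "((\<lambda>t. iter_partial is f (x(i := t))) has_real_derivative h' x) (at (x i))"
      by (rule has_field_derivative_transform_within_open
          [OF h'(2)[rule_format, OF x] openin_coordinate_line[OF U x i]])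
        (use x h(2) in auto)
    then show ?thesis
      by (simp add: iter_partial_def partial_deriv_def DERIV_imp_deriv)
  qed
  with h'(1) show ?case by blast
qed

lemma elementary_on_smooth:
  assumes U: "openin (Euclidean_space d) U" and f: "f \<in> elementary_on U"
  shows "smooth_on d U f"
  unfolding smooth_on_def
proof (intro conjI ballI allI impI)
  fix "is" assume "is": "is \<in> lists {..<d}"
  obtain h where h: "h \<in> elementary_on U" "\<forall>x\<in>U. iter_partial is f x = h x"
    using elementary_on_iter_partial[OF U f "is"] by blast
  have "continuous_on U (iter_partial is f)"
    using elementary_on_continuous[OF h(1)] h(2) by (simp cong: continuous_on_cong)
  then show "continuous_map (subtopology (Euclidean_space d) U) euclideanreal (iter_partial is f)"
    using U by (simp add: subtopology_Euclidean_space openin_subset)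
  fix x i assume x: "x \<in> U" and i: "i < d"
  obtain h' where
    "\<forall>x\<in>U. ((\<lambda>t. h (x(i := t))) has_real_derivative h' x) (at (x i))"
    using elementary_on_partial[OF h(1)] by blast
  then have "((\<lambda>t. iter_partial is f (x(i := t))) has_real_derivative h' x) (at (x i))"
    by (rule has_field_derivative_transform_within_open
        [OF bspec[OF _ x] openin_coordinate_line[OF U x i]])
      (use x h(2) in auto)
  then show "(\<lambda>t. iter_partial is f (x(i := t))) differentiable (at (x i))"
    by (auto simp: real_differentiable_def)
qed (use U in auto)

lemma smooth_on_continuous:
  assumes "smooth_on d U f"
  shows "continuous_on U f"
proof -
  have "U \<subseteq> topspace (Euclidean_space d)"
    using assms by (auto simp: smooth_on_def dest: openin_subset)
  moreover have "continuous_map (subtopology (Euclidean_space d) U) euclideanreal (iter_partial [] f)"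
    using assms unfolding smooth_on_def by blast
  ultimately show ?thesis
    by (simp add: subtopology_Euclidean_space iter_partial_def)
qed

lemma elementary_on_smooth_map:
  assumes U: "openin (Euclidean_space a) U" and "A \<subseteq> U"
    and B: "B \<subseteq> topspace (Euclidean_space b)" and "f ` A \<subseteq> B"
    and f: "\<And>j. j < b \<Longrightarrow> (\<lambda>z. f z j) \<in> elementary_on U"
  shows "smooth_map a A b B f"
  unfolding smooth_map_def
proof (intro conjI ballI)
  show "A \<subseteq> topspace (Euclidean_space a)"
    using \<open>A \<subseteq> U\<close> openin_subset[OF U] by blast
  show "\<exists>U F. x \<in> U \<and> (\<forall>j<b. smooth_on a U (\<lambda>z. F z j)) \<and> openin (Euclidean_space a) U \<and>
      (\<forall>z\<in>U \<inter> A. \<forall>j<b. F z j = f z j)" if "x \<in> A" for x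
    using that U \<open>A \<subseteq> U\<close> elementary_on_smooth[OF U f] by (intro exI[of _ U] exI[of _ f]) auto
qed fact+

section \<open>Invariance of dimension\<close>

lemma smooth_map_continuous_on:
  assumes f: "smooth_map a A b B f"
  shows "continuous_on A f"
proof (rule continuous_on_coordinatewise_then_product)
  fix j
  show "continuous_on A (\<lambda>x. f x j)"
  proof (cases "j < b")
    case False
    have "f ` A \<subseteq> topspace (Euclidean_space b)"
      using f unfolding smooth_map_def by blast
    then have "\<forall>x\<in>A. f x j = 0"
      using False by (auto simp: topspace_Euclidean_space)
    then show ?thesis
      by (intro continuous_on_eq[OF continuous_on_const]) auto
  next
    case True
    show ?thesis
      unfolding continuous_on_eq_continuous_within
    proof
      fix x assume x: "x \<in> A"
      with f have "\<exists>U F. x \<in> U \<and> (\<forall>j<b. smooth_on a U (\<lambda>z. F z j)) \<and>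
          openin (Euclidean_space a) U \<and> (\<forall>z\<in>U \<inter> A. \<forall>j<b. F z j = f z j)"
        unfolding smooth_map_def by (elim conjE) (erule bspec)
      then obtain U F where "x \<in> U" "\<forall>j<b. smooth_on a U (\<lambda>z. F z j)"
        and U: "openin (Euclidean_space a) U" and "\<forall>z\<in>U \<inter> A. \<forall>j<b. F z j = f z j"
        by blast
      then have F: "smooth_on a U (\<lambda>z. F z j)" and eq: "\<forall>z\<in>U \<inter> A. F z j = f z j"
        using True by simp_all
      obtain V where V: "open V" "U = topspace (Euclidean_space a) \<inter> V"
        using U unfolding openin_Euclidean_space_iff by blast
      have AV: "A \<inter> V = U \<inter> A"
        using f V by (auto simp: smooth_map_def)
      have "continuous_on (A \<inter> V) (\<lambda>z. F z j)"
        unfolding AV using smooth_on_continuous[OF F] by (rule continuous_on_subset) auto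
      then have "continuous_on (A \<inter> V) (\<lambda>z. f z j)"
        unfolding AV by (rule continuous_on_eq) (use eq in auto)
      then have "continuous (at x within A \<inter> V) (\<lambda>z. f z j)"
        unfolding continuous_on_eq_continuous_within using x \<open>x \<in> U\<close> V(2) by blast
      moreover have "at x within A \<inter> V = at x within A"
        by (rule at_within_nhd[of x V]) (use V \<open>x \<in> U\<close> in auto)
      ultimately show "continuous (at x within A) (\<lambda>z. f z j)" by simp
    qed
  qed
qed

text \<open>
  An open set contains an open piece of the line through any of its points in direction \<open>n\<close>,
  whereas the coordinate with number \<open>n\<close> vanishes on \<open>\<real>\<^sup>n\<close>.
\<close>

lemma openin_not_in_smaller_Euclidean_space:
  assumes S: "openin (Euclidean_space m) S" "S \<subseteq> topspace (Euclidean_space n)" and "n < m"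
  shows "S = {}"
proof (rule ccontr)
  assume "S \<noteq> {}"
  then obtain x where x: "x \<in> S" by blast
  have "t = 0" if "x(n := t) \<in> S" for t
  proof -
    have "\<forall>i\<ge>n. (x(n := t)) i = 0"
      using S(2) that unfolding topspace_Euclidean_space by blast
    then have "(x(n := t)) n = 0" by blast
    then show ?thesis by simp
  qed
  then have "{t. x(n := t) \<in> S} \<subseteq> {0}" by blast
  moreover have "x n \<in> {t. x(n := t) \<in> S}"
    using x by simp
  ultimately have "{t. x(n := t) \<in> S} = {0}"
    by (metis empty_iff subset_singletonD)
  with openin_coordinate_line[OF S(1) x \<open>n < m\<close>] show False
    by (simp add: not_open_singleton)
qed

text \<open>
  If \<open>n < m\<close>, the map can be read as a map into \<open>\<real>\<^sup>m\<close>.  Invariance of domain makes its image open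
  there, which contradicts the previous lemma.
\<close>

lemma continuous_inj_Euclidean_dim_le:
  assumes U: "openin (Euclidean_space m) U" "U \<noteq> {}"
    and f: "continuous_on U f" "inj_on f U" "f ` U \<subseteq> topspace (Euclidean_space n)"
  shows "m \<le> n"
proof (rule ccontr)
  assume "\<not> m \<le> n"
  then have "topspace (Euclidean_space n) \<subseteq> topspace (Euclidean_space m)" by simp
  with f(3) have *: "f ` U \<subseteq> topspace (Euclidean_space m)" by (rule subset_trans)
  have "continuous_map (subtopology (Euclidean_space m) U) (Euclidean_space m) f"
    unfolding subtopology_Euclidean_space[OF openin_subset[OF U(1)]]
    by (subst Euclidean_space_eq_top_of_set) (use f(1) * in auto)
  with U(1) f(2) have "openin (Euclidean_space m) (f ` U)"
    by (intro invariance_of_domain_Euclidean_space)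
  with f(3) \<open>\<not> m \<le> n\<close> U(2) show False
    using openin_not_in_smaller_Euclidean_space[of m "f ` U" n] by auto
qed

lemma diffeomorphic_sym: "diffeomorphic a A b B \<Longrightarrow> diffeomorphic b B a A"
  unfolding diffeomorphic_def by blast

lemma diffeomorphic_continuous_bij:
  assumes "diffeomorphic a A b B"
  obtains f where "continuous_on A f" "inj_on f A" "f ` A = B"
proof -
  obtain f g where fg: "smooth_map a A b B f" "smooth_map b B a A g"
      "\<forall>x\<in>A. g (f x) = x" "\<forall>y\<in>B. f (g y) = y"
    using assms unfolding diffeomorphic_def by blast
  have "B \<subseteq> f ` A"
    using fg(2,4) unfolding smooth_map_def by (metis imageI subsetD subsetI)
  then have "f ` A = B"
    using fg(1) unfolding smooth_map_def by blast
  moreover have "inj_on f A"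
    using fg(3) by (intro inj_on_inverseI[of A g]) simp
  ultimately show thesis
    using that smooth_map_continuous_on[OF fg(1)] by blast
qed

text \<open>
  The transition map between a \<open>d\<close>-dimensional and an \<open>e\<close>-dimensional chart at \<open>x\<close> is a continuous
  injection of a nonempty open subset of \<open>\<real>\<^sup>d\<close> into \<open>\<real>\<^sup>e\<close>.
\<close>

lemma manifold_dim_le:
  assumes M: "manifold N d M" "x \<in> M" and "manifold N e M"
  shows "d \<le> e"
proof -
  obtain W V where W: "x \<in> W" "openin (subtopology (Euclidean_space N) M) W"
    and V: "openin (Euclidean_space d) V" "diffeomorphic N W d V"
    using M unfolding manifold_def by blast
  obtain W' V' where W': "x \<in> W'" "openin (subtopology (Euclidean_space N) M) W'"
    and V': "openin (Euclidean_space e) V'" "diffeomorphic N W' e V'"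
    using assms unfolding manifold_def by blast
  have sub: "M \<subseteq> topspace (Euclidean_space N)" using M(1) by (simp add: manifold_def)
  obtain p where p: "continuous_on V p" "inj_on p V" "p ` V = W"
    using diffeomorphic_continuous_bij[OF diffeomorphic_sym[OF V(2)]] by blast
  obtain q where q: "continuous_on W' q" "inj_on q W'" "q ` W' = V'"
    using diffeomorphic_continuous_bij[OF V'(2)] by blast
  define P where "P = V \<inter> p -` W'"
  have "openin (top_of_set W) (W \<inter> W')"
    using openin_imp_subset[OF W(2)] openin_Int[OF W(2) W'(2)]
    unfolding subtopology_Euclidean_space[OF sub]
    by (intro openin_subset_trans[of M "W \<inter> W'" W]) auto
  then have "openin (top_of_set V) (V \<inter> p -` (W \<inter> W'))"
    using p by (intro continuous_openin_preimage[of V p W]) auto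
  moreover have "V \<inter> p -` (W \<inter> W') = P"
    using p(3) by (auto simp: P_def)
  ultimately have "openin (subtopology (Euclidean_space d) V) P"
    by (simp add: subtopology_Euclidean_space[OF openin_subset[OF V(1)]])
  then have "openin (Euclidean_space d) P"
    using V(1) by (rule openin_trans_full)
  moreover have "P \<noteq> {}"
    using W(1) W'(1) p(3) by (auto simp: P_def)
  moreover have "continuous_on P (q \<circ> p)"
    by (intro continuous_on_compose continuous_on_subset[OF p(1)] continuous_on_subset[OF q(1)])
      (auto simp: P_def)
  moreover have "inj_on (q \<circ> p) P"
    by (intro comp_inj_on inj_on_subset[OF p(2)] inj_on_subset[OF q(2)]) (auto simp: P_def)
  moreover have "(q \<circ> p) ` P \<subseteq> topspace (Euclidean_space e)"
    using q(3) openin_subset[OF V'(1)] by (auto simp: P_def)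
  ultimately show ?thesis
    by (rule continuous_inj_Euclidean_dim_le)
qed

section \<open>Cells and subsets\<close>

text \<open>
  The cell of \<open>(k, \<sigma>)\<close> depends on \<open>\<sigma>\<close> only through the set \<open>\<sigma> ` {1..k}\<close> of the indices of the
  planes in which a point has a nonzero component.  Strata are indexed by this set.
\<close>

definition stratum :: "nat \<Rightarrow> nat set \<Rightarrow> (nat \<Rightarrow> 'a::zero) set" where
  "stratum n S = {p. (\<forall>l\<ge>2*n. p l = 0) \<and>
     (\<forall>i\<in>{1..n}. (xc i p, yc i p) \<noteq> (0, 0) \<longleftrightarrow> i \<in> S)}"

lemma permutes_image_tail:
  fixes \<sigma> :: "nat \<Rightarrow> nat"
  assumes "\<sigma> permutes {1..n}" "k \<le> n"
  shows "\<sigma> ` {k<..n} = {1..n} - \<sigma> ` {1..k}"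
proof -
  have "{k<..n} = {1..n} - {1..k}" using assms(2) by auto
  then show ?thesis
    using permutes_image[OF assms(1)] by (simp add: image_set_diff permutes_inj[OF assms(1)])
qed

lemma cell_eq_stratum:
  assumes "\<sigma> permutes {1..n}" "k \<le> n"
  shows "cell n k \<sigma> = stratum n (\<sigma> ` {1..k})"
proof -
  have sub: "\<sigma> ` {1..k} \<subseteq> {1..n}"
    using permutes_image[OF assms(1)] assms(2) by (metis atLeastatMost_subset_iff image_mono le_refl)
  have "(\<forall>i\<in>{1..k}. P (\<sigma> i)) \<and> (\<forall>i\<in>{k<..n}. \<not> P (\<sigma> i)) \<longleftrightarrow>
      (\<forall>i\<in>{1..n}. P i \<longleftrightarrow> i \<in> \<sigma> ` {1..k})" for P
  proof -
    have "(\<forall>i\<in>{k<..n}. \<not> P (\<sigma> i)) \<longleftrightarrow> (\<forall>i\<in>{1..n} - \<sigma> ` {1..k}. \<not> P i)"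
      unfolding permutes_image_tail[OF assms, symmetric] by blast
    then show ?thesis using sub by blast
  qed
  from this[of "\<lambda>i. (xc i p, yc i p) \<noteq> (0, 0)" for p :: "nat \<Rightarrow> 'a"] show ?thesis
    unfolding cell_def stratum_def by (simp only: not_not)
qed

lemma stratum_disjoint:
  assumes "S \<subseteq> {1..n}" "T \<subseteq> {1..n}" "S \<noteq> T"
  shows "stratum n S \<inter> stratum n T = {}"
  using assms unfolding stratum_def by blast

lemma stratum_nonempty: "(stratum n S :: (nat \<Rightarrow> real) set) \<noteq> {}"
proof -
  \<comment> \<open>Both coordinates are \<open>1\<close> in the planes of \<open>S\<close>; the coordinate \<open>l\<close> belongs to the plane \<open>l div 2 + 1\<close>.\<close>
  have "(\<lambda>l. if l < 2*n \<and> l div 2 + 1 \<in> S then 1 else 0 :: real) \<in> stratum n S"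
    unfolding stratum_def xc_def yc_def
  proof (intro CollectI conjI allI ballI impI)
    fix i assume i: "i \<in> {1..n}"
    then obtain m where m: "i = Suc m" "m < n" by (cases i) auto
    then show "((if 2 * i - 2 < 2 * n \<and> (2 * i - 2) div 2 + 1 \<in> S then 1 else 0,
        if 2 * i - 1 < 2 * n \<and> (2 * i - 1) div 2 + 1 \<in> S then 1 else 0) \<noteq> (0, 0::real)) = (i \<in> S)"
      by auto
  qed auto
  then show ?thesis by blast
qed

lemma permsD:
  assumes "\<sigma> \<in> perms n k"
  shows "\<sigma> permutes {1..n}" "strict_mono_on {1..k} \<sigma>" "strict_mono_on {k<..n} \<sigma>"
  using assms unfolding perms_def strict_mono_on_def by auto

lemma strict_mono_on_image_unique:
  fixes f g :: "nat \<Rightarrow> nat"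
  assumes "strict_mono_on {a..<b} f" "strict_mono_on {a..<b} g" "f ` {a..<b} = g ` {a..<b}"
    and x: "x \<in> {a..<b}"
  shows "f x = g x"
proof -
  have sd: "sorted (map h [a..<b]) \<and> distinct (map h [a..<b])" if "strict_mono_on {a..<b} h" for h :: "nat \<Rightarrow> nat"
  proof -
    have "sorted_wrt (<) (map h [a..<b])"
      unfolding sorted_wrt_map
      by (rule sorted_wrt_mono_rel[OF _ sorted_wrt_upt])
        (use that in \<open>auto simp: strict_mono_on_def\<close>)
    then show ?thesis by (simp add: strict_sorted_iff)
  qed
  \<comment> \<open>A set has only one increasing enumeration.\<close>
  have "map f [a..<b] = map g [a..<b]"
    using sd[OF assms(1)] sd[OF assms(2)] assms(3) by (intro sorted_distinct_set_unique) auto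
  with x show ?thesis by simp
qed

text \<open>
  Both blocks \<open>{1..k}\<close> and \<open>{k<..n}\<close> are mapped increasingly, onto a given set and onto its
  complement.
\<close>

lemma perms_determined_by_image:
  assumes \<sigma>: "\<sigma> \<in> perms n k" and \<tau>: "\<tau> \<in> perms n k" and "k \<le> n"
    and img: "\<sigma> ` {1..k} = \<tau> ` {1..k}"
  shows "\<sigma> = \<tau>"
proof
  fix i
  have 1: "{1..k} = {1..<Suc k}" and 2: "{k<..n} = {Suc k..<Suc n}" by auto
  have img': "\<sigma> ` {k<..n} = \<tau> ` {k<..n}"
    using img permutes_image_tail[OF permsD(1)[OF \<sigma>] \<open>k \<le> n\<close>] permutes_image_tail[OF permsD(1)[OF \<tau>] \<open>k \<le> n\<close>]
    by simp
  consider "i \<in> {1..k}" | "i \<in> {k<..n}" | "i \<notin> {1..n}"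
    unfolding atLeastAtMost_iff greaterThanAtMost_iff by linarith
  then show "\<sigma> i = \<tau> i"
  proof cases
    case 1
    then show ?thesis
      using strict_mono_on_image_unique[of 1 "Suc k" \<sigma> \<tau> i] permsD(2)[OF \<sigma>] permsD(2)[OF \<tau>] img
      unfolding \<open>{1..k} = {1..<Suc k}\<close> by blast
  next
    case 2
    then show ?thesis
      using strict_mono_on_image_unique[of "Suc k" "Suc n" \<sigma> \<tau> i] permsD(3)[OF \<sigma>] permsD(3)[OF \<tau>] img'
      unfolding \<open>{k<..n} = {Suc k..<Suc n}\<close> by blast
  next
    case 3
    then show ?thesis
      using permsD(1)[OF \<sigma>] permsD(1)[OF \<tau>] by (simp add: permutes_not_in)
  qed
qed

text \<open>
  The permutation lists the elements of \<open>S\<close> in increasing order and then those of the complement.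
\<close>

lemma perms_image_surj:
  assumes S: "S \<subseteq> {1..n}" "card S = k"
  shows "\<exists>\<sigma>\<in>perms n k. \<sigma> ` {1..k} = S"
proof -
  let ?T = "{1..n} - S"
  have fin: "finite S" "finite ?T" using S(1) finite_subset by auto
  have k: "k \<le> n" using card_mono[OF _ S(1)] S(2) by simp
  have cT: "card ?T = n - k" using S fin by (simp add: card_Diff_subset)
  obtain f where f: "bij_betw f {..<k} S" "strict_mono_on {..<k} f"
    by (rule ex_bij_betw_strict_mono_card[OF fin(1), unfolded S(2)])
  obtain g where g: "bij_betw g {..<n-k} ?T" "strict_mono_on {..<n-k} g"
    by (rule ex_bij_betw_strict_mono_card[OF fin(2), unfolded cT])
  define \<sigma> where "\<sigma> i = (if i \<in> {1..k} then f (i - 1) else if i \<in> {k<..n} then g (i - Suc k) else i)" for i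
  have "bij_betw (\<lambda>i. i - 1) {1..k} {..<k}"
    by (rule bij_betw_byWitness[of _ "\<lambda>i. i + 1"]) auto
  then have "bij_betw (f \<circ> (\<lambda>i. i - 1)) {1..k} S"
    using f(1) by (rule bij_betw_trans)
  then have b1: "bij_betw \<sigma> {1..k} S"
    by (rule iffD1[OF bij_betw_cong, rotated]) (auto simp: \<sigma>_def)
  have "bij_betw (\<lambda>i. i - Suc k) {k<..n} {..<n-k}"
    by (rule bij_betw_byWitness[of _ "\<lambda>i. i + Suc k"]) auto
  then have "bij_betw (g \<circ> (\<lambda>i. i - Suc k)) {k<..n} ?T"
    using g(1) by (rule bij_betw_trans)
  then have b2: "bij_betw \<sigma> {k<..n} ?T"
    by (rule iffD1[OF bij_betw_cong, rotated]) (auto simp: \<sigma>_def)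
  have "bij_betw \<sigma> ({1..k} \<union> {k<..n}) (S \<union> ?T)"
    by (rule bij_betw_combine[OF b1 b2]) auto
  moreover have "{1..k} \<union> {k<..n} = {1..n}" "S \<union> ?T = {1..n}" using k S by auto
  ultimately have "\<sigma> permutes {1..n}"
    by (intro bij_imp_permutes) (use k in \<open>auto simp: \<sigma>_def\<close>)
  moreover have "\<sigma> i < \<sigma> j" if "1 \<le> i" "i < j" "j \<le> k" for i j
    using that strict_mono_onD[OF f(2), of "i - 1" "j - 1"] by (simp add: \<sigma>_def)
  moreover have "\<sigma> i < \<sigma> j" if "k < i" "i < j" "j \<le> n" for i j
    using that strict_mono_onD[OF g(2), of "i - Suc k" "j - Suc k"] by (simp add: \<sigma>_def)
  ultimately have "\<sigma> \<in> perms n k" by (simp add: perms_def)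
  moreover have "\<sigma> ` {1..k} = S" using b1 by (simp add: bij_betw_def)
  ultimately show ?thesis by blast
qed

lemma perms_bij_subsets:
  assumes "k \<le> n"
  shows "bij_betw (\<lambda>\<sigma>. \<sigma> ` {1..k}) (perms n k) {S. S \<subseteq> {1..n} \<and> card S = k}"
  unfolding bij_betw_def
proof (intro conjI inj_onI equalityI subsetI)
  show "\<sigma> = \<tau>" if "\<sigma> \<in> perms n k" "\<tau> \<in> perms n k" "\<sigma> ` {1..k} = \<tau> ` {1..k}" for \<sigma> \<tau>
    using that(1,2) assms that(3) by (rule perms_determined_by_image)
next
  fix S assume "S \<in> (\<lambda>\<sigma>. \<sigma> ` {1..k}) ` perms n k"
  then obtain \<sigma> where \<sigma>: "\<sigma> \<in> perms n k" "S = \<sigma> ` {1..k}" by blast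
  note p = permsD(1)[OF \<sigma>(1)]
  have "S \<subseteq> {1..n}"
    using permutes_image[OF p] assms \<sigma>(2) by (metis atLeastatMost_subset_iff image_mono le_refl)
  moreover have "card S = k"
    using card_image[OF inj_on_subset[OF permutes_inj[OF p]], of "{1..k}"] \<sigma>(2) by simp
  ultimately show "S \<in> {S. S \<subseteq> {1..n} \<and> card S = k}" by simp
next
  fix S assume "S \<in> {S. S \<subseteq> {1..n} \<and> card S = k}"
  then show "S \<in> (\<lambda>\<sigma>. \<sigma> ` {1..k}) ` perms n k"
    using perms_image_surj[of S n k] by blast
qed

lemma card_perms: "k \<le> n \<Longrightarrow> card (perms n k) = n choose k"
  using bij_betw_same_card[OF perms_bij_subsets[of k n]] n_subsets[of "{1..n}" k] by simp

lemma perms_0: "perms n 0 = {id}"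
proof -
  have "id \<in> perms n 0" by (simp add: perms_def permutes_id)
  moreover have "\<sigma> = id" if "\<sigma> \<in> perms n 0" for \<sigma>
    using that calculation by (rule perms_determined_by_image) simp_all
  ultimately show ?thesis by blast
qed

section \<open>Invariance under the flows\<close>

text \<open>
  In the \<open>i\<close>-th plane, an Eulerian field is the sum of a rotation and a dilation, whose coefficients
  are functions on the whole space.  Therefore its component in this plane vanishes at every point
  whose own component there is zero.
\<close>

lemma eulerian_field_block:
  fixes \<omega> :: "nat \<Rightarrow> 'a::comm_ring_1"
  assumes i: "i \<in> {1..n}"
  shows "eulerian_field n \<omega> f g p (2*i - 2) = - (\<omega> i + f i) * yc i p + g * xc i p"
    and "eulerian_field n \<omega> f g p (2*i - 1) = (\<omega> i + f i) * xc i p + g * yc i p"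
proof -
  have x: "rot_field j p (2*i - 2) = (if j = i then - yc i p else 0)"
    and y: "rot_field j p (2*i - 1) = (if j = i then xc i p else 0)" if "j \<in> {1..n}" for j
  proof -
    define a b where "a = i - 1" and "b = j - 1"
    have ab: "i = Suc a" "j = Suc b"
      using that i by (auto simp: a_def b_def)
    have "2 * a \<noteq> Suc (2 * b)" "Suc (2 * a) \<noteq> 2 * b" by presburger+
    then show "rot_field j p (2*i - 2) = (if j = i then - yc i p else 0)"
      and "rot_field j p (2*i - 1) = (if j = i then xc i p else 0)"
      by (auto simp: rot_field_def ab)
  qed
  have sx: "(\<Sum>j=1..n. h j * rot_field j p (2*i - 2)) = - h i * yc i p"
    and sy: "(\<Sum>j=1..n. h j * rot_field j p (2*i - 1)) = h i * xc i p" for h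
  proof -
    have "(\<Sum>j=1..n. h j * rot_field j p (2*i - 2)) = (\<Sum>j=1..n. if j = i then - h i * yc i p else 0)"
      by (intro sum.cong refl) (subst x, assumption, simp)
    then show "(\<Sum>j=1..n. h j * rot_field j p (2*i - 2)) = - h i * yc i p" using i by simp
    have "(\<Sum>j=1..n. h j * rot_field j p (2*i - 1)) = (\<Sum>j=1..n. if j = i then h i * xc i p else 0)"
      by (intro sum.cong refl) (subst y, assumption, simp)
    then show "(\<Sum>j=1..n. h j * rot_field j p (2*i - 1)) = h i * xc i p" using i by simp
  qed
  have e: "euler_field n p (2*i - 2) = xc i p" "euler_field n p (2*i - 1) = yc i p"
    using i by (auto simp: euler_field_def xc_def yc_def)
  show "eulerian_field n \<omega> f g p (2*i - 2) = - (\<omega> i + f i) * yc i p + g * xc i p"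
    unfolding eulerian_field_def sx e by (simp add: algebra_simps)
  show "eulerian_field n \<omega> f g p (2*i - 1) = (\<omega> i + f i) * xc i p + g * yc i p"
    unfolding eulerian_field_def sy e by (simp add: algebra_simps)
qed

text \<open>
  With an antiderivative \<open>H\<close> of \<open>h\<close>, the product of \<open>r\<close> and \<open>exp (- H)\<close> is constant.  Only a
  compact piece \<open>{a..b}\<close> of the interval matters, so \<open>H\<close> can be taken as an integral from \<open>a\<close>.
\<close>

lemma linear_ode_zero_iff:
  fixes r h :: "real \<Rightarrow> real"
  assumes T: "is_interval T" and h: "continuous_on T h"
    and r: "\<And>t. t \<in> T \<Longrightarrow> (r has_real_derivative h t * r t) (at t within T)"
    and ab: "a \<in> T" "b \<in> T"
  shows "r a = 0 \<longleftrightarrow> r b = 0"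
proof -
  have main: "r a = 0 \<longleftrightarrow> r b = 0" if ab: "a \<in> T" "b \<in> T" "a \<le> b" for a b
  proof -
    have sub: "{a..b} \<subseteq> T"
      using T ab mem_is_interval_1_I[OF T] by (meson atLeastAtMost_iff subsetI)
    define H where "H t = integral {a..t} h" for t
    have H: "(H has_real_derivative h t) (at t within {a..b})" if "t \<in> {a..b}" for t
      unfolding H_def using continuous_on_subset[OF h sub] that
      by (rule integral_has_real_derivative)
    have "((\<lambda>t. r t * exp (- H t)) has_real_derivative 0) (at t within {a..b})" if "t \<in> {a..b}" for t
    proof -
      have "(r has_real_derivative h t * r t) (at t within {a..b})"
        by (rule has_field_derivative_subset[OF r sub]) (use that sub in blast)
      moreover have "((\<lambda>t. exp (- H t)) has_real_derivative exp (- H t) * - h t) (at t within {a..b})"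
        using H[OF that] by (auto intro!: derivative_eq_intros)
      ultimately have "((\<lambda>t. r t * exp (- H t)) has_real_derivative
          h t * r t * exp (- H t) + exp (- H t) * - h t * r t) (at t within {a..b})"
        by (rule DERIV_mult)
      then show ?thesis by simp
    qed
    then have "\<exists>c. \<forall>t\<in>{a..b}. r t * exp (- H t) = c"
      by (intro has_field_derivative_zero_constant convex_real_interval)
    then obtain c where c: "\<forall>t\<in>{a..b}. r t * exp (- H t) = c" ..
    have "r a * exp (- H a) = c" "r b * exp (- H b) = c"
      using c \<open>a \<le> b\<close> by simp_all
    then have "r a * exp (- H a) = r b * exp (- H b)" by (rule trans[OF _ sym])
    then have "r a * exp (- H a) = 0 \<longleftrightarrow> r b * exp (- H b) = 0" by (rule arg_cong)
    then show ?thesis by simp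
  qed
  show ?thesis
  proof (cases "a \<le> b")
    case True
    with ab show ?thesis by (rule main)
  next
    case False
    with ab show ?thesis by (intro main[symmetric]) simp_all
  qed
qed

lemma DERIV_sum_squares:
  fixes f g :: "real \<Rightarrow> real"
  assumes "(f has_real_derivative f') (at t within S)" "(g has_real_derivative g') (at t within S)"
  shows "((\<lambda>s. (f s)\<^sup>2 + (g s)\<^sup>2) has_real_derivative 2 * (f t * f' + g t * g')) (at t within S)"
  using assms by (auto intro!: derivative_eq_intros simp: algebra_simps)

text \<open>
  The rotation does not change the squared radius \<open>r\<close> in the \<open>i\<close>-th plane, so along a trajectory
  \<open>r\<close> satisfies the linear equation \<open>r' = 2 G r\<close>.
\<close>

lemma eulerian_trajectory_block_zero_iff:
  assumes \<gamma>: "eulerian_trajectory n \<omega> F G U T \<gamma>" and U: "openin (Euclidean_space (2*n)) U"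
    and G: "smooth_on (2*n) U G" and i: "i \<in> {1..n}" and t: "t \<in> T"
  shows "(xc i (\<gamma> t), yc i (\<gamma> t)) = (0, 0) \<longleftrightarrow> (xc i (\<gamma> 0), yc i (\<gamma> 0)) = (0, 0)"
proof -
  define r where "r t = (xc i (\<gamma> t))\<^sup>2 + (yc i (\<gamma> t))\<^sup>2" for t
  have T: "is_interval T" "0 \<in> T"
    using \<gamma> by (simp_all add: eulerian_trajectory_def)
  have inU: "\<gamma> s \<in> U" if "s \<in> T" for s
    using \<gamma> that by (simp add: eulerian_trajectory_def)
  have deriv: "((\<lambda>s. \<gamma> s l) has_real_derivative
      eulerian_field n \<omega> (\<lambda>i. F i (\<gamma> s)) (G (\<gamma> s)) (\<gamma> s) l) (at s within T)"
    if "s \<in> T" "l < 2*n" for s l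
    using \<gamma> that by (simp add: eulerian_trajectory_def)
  have "continuous_on T \<gamma>"
  proof (rule continuous_on_coordinatewise_then_product)
    fix l
    show "continuous_on T (\<lambda>s. \<gamma> s l)"
    proof (cases "l < 2*n")
      case True
      then show ?thesis
        unfolding continuous_on_eq_continuous_within
        by (auto intro: DERIV_continuous deriv)
    next
      case False
      then have "\<gamma> s l = 0" if "s \<in> T" for s
        using inU[OF that] openin_subset[OF U] by (auto simp: topspace_Euclidean_space)
      then show ?thesis
        by (intro continuous_on_eq[OF continuous_on_const]) auto
    qed
  qed
  then have "continuous_on T (\<lambda>s. G (\<gamma> s))"
    by (rule continuous_on_compose2[OF smooth_on_continuous[OF G]]) (use inU in auto)
  then have cont: "continuous_on T (\<lambda>s. 2 * G (\<gamma> s))"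
    by (intro continuous_intros)
  have "(r has_real_derivative 2 * G (\<gamma> s) * r s) (at s within T)" if s: "s \<in> T" for s
  proof -
    let ?\<theta> = "\<omega> i + F i (\<gamma> s)" and ?x = "xc i (\<gamma> s)" and ?y = "yc i (\<gamma> s)" and ?g = "G (\<gamma> s)"
    have l: "2*i - 2 < 2*n" "2*i - 1 < 2*n" using i by auto
    have x: "((\<lambda>s. xc i (\<gamma> s)) has_real_derivative - ?\<theta> * ?y + ?g * ?x) (at s within T)"
      using deriv[OF s l(1)] unfolding eulerian_field_block(1)[OF i] xc_def .
    have y: "((\<lambda>s. yc i (\<gamma> s)) has_real_derivative ?\<theta> * ?x + ?g * ?y) (at s within T)"
      using deriv[OF s l(2)] unfolding eulerian_field_block(2)[OF i] yc_def .
    have "2 * (?x * (- ?\<theta> * ?y + ?g * ?x) + ?y * (?\<theta> * ?x + ?g * ?y)) = 2 * ?g * r s"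
      by (simp add: r_def algebra_simps power2_eq_square)
    with DERIV_sum_squares[OF x y] show ?thesis
      by (simp only: r_def[abs_def])
  qed
  then have "r t = 0 \<longleftrightarrow> r 0 = 0"
    using linear_ode_zero_iff[OF T(1) cont] t T(2) by blast
  then show ?thesis
    by (simp add: r_def sum_power2_eq_zero_iff)
qed

text \<open>
  The constant coefficient of a value only involves the monomial of degree zero.
\<close>

lemma mseries_eval_constant_coeff:
  assumes "a (\<lambda>_. 0) = 0"
  shows "fps_nth (mseries_eval d a z) 0 = 0"
proof -
  have "\<alpha> = (\<lambda>_. 0)" if "\<alpha> \<in> multi_indices d" "(\<Sum>l<d. \<alpha> l) \<le> 0" for \<alpha>
  proof
    fix l
    show "\<alpha> l = 0" using that by (cases "l < d") (auto simp: multi_indices_def)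
  qed
  then show ?thesis
    unfolding mseries_eval_def using assms by (auto intro!: sum.neutral)
qed

lemma fps_mult_nth_lowest:
  fixes a b :: "'a::semiring_1 fps"
  assumes "\<And>j. j < m \<Longrightarrow> fps_nth b j = 0"
  shows "fps_nth (a * b) m = fps_nth a 0 * fps_nth b m"
proof -
  have "fps_nth (a * b) m = (\<Sum>j=0..m. if j = 0 then fps_nth a 0 * fps_nth b m else 0)"
    unfolding fps_mult_nth by (intro sum.cong) (auto simp: assms)
  then show ?thesis by simp
qed

text \<open>
  Suppose that the coefficients of order less than \<open>m\<close> of the component in the \<open>i\<close>-th plane vanish
  at all times.  The values of \<open>f i\<close> and \<open>g\<close> have no constant term, so in order \<open>m\<close> only the linear
  rotation with frequency \<open>\<omega> i\<close> remains.  It preserves the sum of the squares of the two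
  coefficients of order \<open>m\<close>, which is zero at the time \<open>s\<close>.
\<close>

lemma formal_eulerian_trajectory_block_zero:
  assumes fg: "eulerian_data n \<omega> f g" and \<zeta>: "formal_eulerian_trajectory n \<omega> f g \<zeta>"
    and i: "i \<in> {1..n}" and s: "(xc i (\<zeta> s), yc i (\<zeta> s)) = (0, 0)"
  shows "(xc i (\<zeta> t), yc i (\<zeta> t)) = (0, 0)"
proof -
  have zero: "\<forall>t. fps_nth (xc i (\<zeta> t)) m = 0 \<and> fps_nth (yc i (\<zeta> t)) m = 0" for m
  proof (induction m rule: less_induct)
    case (less m)
    define a b where "a t = fps_nth (xc i (\<zeta> t)) m" and "b t = fps_nth (yc i (\<zeta> t)) m" for t
    have deriv: "((\<lambda>t. fps_nth (\<zeta> t l) m) has_real_derivative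
        fps_nth (eulerian_field n (\<lambda>i. fps_const (\<omega> i))
          (\<lambda>i. mseries_eval (2*n) (f i) (\<zeta> t)) (mseries_eval (2*n) g (\<zeta> t)) (\<zeta> t) l) m) (at t)"
      if "l < 2*n" for t l
      using \<zeta> that by (simp add: formal_eulerian_trajectory_def)
    have f0: "fps_nth (mseries_eval (2*n) (f i) z) 0 = 0" for z
      using fg i by (intro mseries_eval_constant_coeff) (simp add: eulerian_data_def)
    have g0: "fps_nth (mseries_eval (2*n) g z) 0 = 0" for z
      using fg by (intro mseries_eval_constant_coeff) (simp add: eulerian_data_def)
    have low: "fps_nth (h * xc i (\<zeta> t)) m = fps_nth h 0 * a t"
      "fps_nth (h * yc i (\<zeta> t)) m = fps_nth h 0 * b t" for h t
      unfolding a_def b_def using less by (intro fps_mult_nth_lowest; simp)+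
    have l: "2*i - 2 < 2*n" "2*i - 1 < 2*n" using i by auto
    have a: "(a has_real_derivative - \<omega> i * b t) (at t)" for t
    proof -
      have "(a has_real_derivative fps_nth (- (fps_const (\<omega> i) + mseries_eval (2*n) (f i) (\<zeta> t)) * yc i (\<zeta> t)
          + mseries_eval (2*n) g (\<zeta> t) * xc i (\<zeta> t)) m) (at t)"
        using deriv[OF l(1), of t] unfolding eulerian_field_block(1)[OF i] a_def xc_def .
      then show ?thesis unfolding fps_add_nth low by (simp add: f0 g0)
    qed
    have b: "(b has_real_derivative \<omega> i * a t) (at t)" for t
    proof -
      have "(b has_real_derivative fps_nth ((fps_const (\<omega> i) + mseries_eval (2*n) (f i) (\<zeta> t)) * xc i (\<zeta> t)
          + mseries_eval (2*n) g (\<zeta> t) * yc i (\<zeta> t)) m) (at t)"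
        using deriv[OF l(2), of t] unfolding eulerian_field_block(2)[OF i] b_def yc_def .
      then show ?thesis unfolding fps_add_nth low by (simp add: f0 g0)
    qed
    have "((\<lambda>t. (a t)\<^sup>2 + (b t)\<^sup>2) has_real_derivative 0) (at t)" for t
      using DERIV_sum_squares[OF a[of t] b[of t]] by (simp add: algebra_simps)
    then have "(a t)\<^sup>2 + (b t)\<^sup>2 = (a s)\<^sup>2 + (b s)\<^sup>2" for t
      by (intro DERIV_isconst_all) simp
    moreover have "a s = 0" "b s = 0" using s by (simp_all add: a_def b_def)
    ultimately show ?case
      by (simp add: sum_power2_eq_zero_iff flip: a_def b_def)
  qed
  then show ?thesis by (simp add: fps_eq_iff)
qed

lemma cell_cong:
  assumes "p \<in> cell n k \<sigma>" "\<sigma> permutes {1..n}" "k \<le> n" "\<forall>l\<ge>2*n. q l = 0"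
    and "\<And>i. i \<in> {1..n} \<Longrightarrow> (xc i q, yc i q) = (0, 0) \<longleftrightarrow> (xc i p, yc i p) = (0, 0)"
  shows "q \<in> cell n k \<sigma>"
proof -
  have p: "\<forall>i\<in>{1..n}. (xc i p, yc i p) \<noteq> (0, 0) \<longleftrightarrow> i \<in> \<sigma> ` {1..k}"
    using assms(1) unfolding cell_eq_stratum[OF assms(2,3)] stratum_def by blast
  have "(xc i q, yc i q) \<noteq> (0, 0) \<longleftrightarrow> i \<in> \<sigma> ` {1..k}" if "i \<in> {1..n}" for i
    using bspec[OF p that] assms(5)[OF that] by argo
  with assms(4) show ?thesis
    unfolding cell_eq_stratum[OF assms(2,3)] stratum_def by blast
qed

lemma cell_eulerian_flow_invariant:
  assumes \<sigma>: "\<sigma> permutes {1..n}" "k \<le> n"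
  shows "eulerian_flow_invariant n (cell n k \<sigma>)"
  unfolding eulerian_flow_invariant_def
proof (intro allI impI ballI, elim conjE)
  fix \<omega> f g U F G T \<gamma> t
  assume U: "openin (Euclidean_space (2*n)) U" and G: "has_taylor_series (2*n) U G g"
    and \<gamma>: "eulerian_trajectory n \<omega> F G U T \<gamma>" and 0: "\<gamma> 0 \<in> cell n k \<sigma>" and t: "t \<in> T"
  from G have "smooth_on (2*n) U G" by (simp add: has_taylor_series_def)
  note * = eulerian_trajectory_block_zero_iff[OF \<gamma> U this _ t]
  have "\<gamma> t \<in> U" using \<gamma> t by (simp add: eulerian_trajectory_def)
  then have "\<forall>l\<ge>2*n. \<gamma> t l = 0"
    using openin_subset[OF U] by (auto simp: topspace_Euclidean_space)
  with 0 \<sigma> show "\<gamma> t \<in> cell n k \<sigma>"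
    by (rule cell_cong) (rule *)
qed

lemma cell_formal_eulerian_flow_invariant:
  assumes \<sigma>: "\<sigma> permutes {1..n}" "k \<le> n"
  shows "formal_eulerian_flow_invariant n (cell n k \<sigma>)"
  unfolding formal_eulerian_flow_invariant_def
proof (intro allI impI, elim conjE)
  fix \<omega> f g \<zeta> t
  assume fg: "eulerian_data n \<omega> f g" and \<zeta>: "formal_eulerian_trajectory n \<omega> f g \<zeta>"
    and 0: "\<zeta> 0 \<in> cell n k \<sigma>"
  have "\<forall>l\<ge>2*n. \<zeta> t l = 0" using \<zeta> by (simp add: formal_eulerian_trajectory_def)
  with 0 \<sigma> show "\<zeta> t \<in> cell n k \<sigma>"
    by (rule cell_cong) (use formal_eulerian_trajectory_block_zero[OF fg \<zeta>] in blast)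
qed

section \<open>Charts of the cells\<close>

text \<open>
  For the charts, planes are numbered from \<open>0\<close>, so that the plane with number \<open>q\<close> has the
  coordinates \<open>2 q\<close> and \<open>2 q + 1\<close>, and \<open>\<tau> m\<close> is the plane in position \<open>m\<close>.  The open set
  \<open>block_domain\<close> is used twice: with \<open>d = 2 n\<close> it is the neighbourhood of a cell on which the polar
  coordinates of the planes in the first \<open>k\<close> positions are smooth, and with \<open>d = 2 k\<close> and \<open>\<tau>\<close> the identity it is the
  image of a global chart of the cell.
\<close>

definition block_domain :: "nat \<Rightarrow> nat \<Rightarrow> (nat \<Rightarrow> nat) \<Rightarrow> (nat \<Rightarrow> real) set" where
  "block_domain d k \<tau> = {p \<in> topspace (Euclidean_space d).
     \<forall>m<k. p (2 * \<tau> m) \<noteq> 0 \<or> p (2 * \<tau> m + 1) \<noteq> 0}"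

definition block_cell :: "nat \<Rightarrow> nat \<Rightarrow> (nat \<Rightarrow> nat) \<Rightarrow> (nat \<Rightarrow> real) set" where
  "block_cell n k \<tau> = {p \<in> block_domain (2*n) k \<tau>.
     \<forall>m\<in>{k..<n}. p (2 * \<tau> m) = 0 \<and> p (2 * \<tau> m + 1) = 0}"

lemma cell_eq_block_cell:
  assumes \<sigma>: "\<sigma> permutes {1..n}" and "k \<le> n"
  shows "cell n k \<sigma> = block_cell n k (\<lambda>m. \<sigma> (Suc m) - 1)"
proof -
  have c: "xc (\<sigma> (Suc m)) p = p (2 * (\<sigma> (Suc m) - 1))"
    "yc (\<sigma> (Suc m)) p = p (2 * (\<sigma> (Suc m) - 1) + 1)"
    if "m < n" for m and p :: "nat \<Rightarrow> real"
  proof -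
    have "\<sigma> (Suc m) \<in> {1..n}"
      using that permutes_in_image[OF \<sigma>, of "Suc m"] by simp
    then have "2 * \<sigma> (Suc m) - 1 = 2 * (\<sigma> (Suc m) - 1) + 1" by auto
    then show "xc (\<sigma> (Suc m)) p = p (2 * (\<sigma> (Suc m) - 1))"
      "yc (\<sigma> (Suc m)) p = p (2 * (\<sigma> (Suc m) - 1) + 1)"
      by (simp_all add: xc_def yc_def diff_mult_distrib2)
  qed
  have 1: "{1..k} = Suc ` {..<k}" and 2: "{k<..n} = Suc ` {k..<n}"
    by (auto simp: image_Suc_lessThan image_Suc_atLeastLessThan)
  have "(\<forall>i\<in>{1..k}. (xc (\<sigma> i) p, yc (\<sigma> i) p) \<noteq> (0, 0)) \<longleftrightarrow>
      (\<forall>m<k. p (2 * (\<sigma> (Suc m) - 1)) \<noteq> 0 \<or> p (2 * (\<sigma> (Suc m) - 1) + 1) \<noteq> 0)" for p :: "nat \<Rightarrow> real"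
    unfolding 1 using \<open>k \<le> n\<close> c[of _ p] by simp (simp add: Ball_def)
  moreover have "(\<forall>i\<in>{k<..n}. (xc (\<sigma> i) p, yc (\<sigma> i) p) = (0, 0)) \<longleftrightarrow>
      (\<forall>m\<in>{k..<n}. p (2 * (\<sigma> (Suc m) - 1)) = 0 \<and> p (2 * (\<sigma> (Suc m) - 1) + 1) = 0)" for p :: "nat \<Rightarrow> real"
    unfolding 2 using c[of _ p] by (simp del: image_Suc_atLeastLessThan)
  ultimately show ?thesis
    unfolding cell_def block_cell_def block_domain_def topspace_Euclidean_space by simp
qed

lemma openin_block_domain: "openin (Euclidean_space d) (block_domain d k \<tau>)"
proof -
  have "open {p :: nat \<Rightarrow> real. p a \<noteq> 0}" for a
    by (intro open_Collect_neq continuous_on_product_coordinates continuous_on_const)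
  then have "open (\<Inter>m\<in>{..<k}. {p :: nat \<Rightarrow> real. p (2 * \<tau> m) \<noteq> 0 \<or> p (2 * \<tau> m + 1) \<noteq> 0})"
    by (intro open_INT open_Collect_disj ballI finite_lessThan)
  moreover have "block_domain d k \<tau> = topspace (Euclidean_space d) \<inter>
      (\<Inter>m\<in>{..<k}. {p. p (2 * \<tau> m) \<noteq> 0 \<or> p (2 * \<tau> m + 1) \<noteq> 0})"
    by (auto simp: block_domain_def)
  ultimately show ?thesis
    unfolding openin_Euclidean_space_iff by blast
qed

lemma block_div_mod:
  fixes e :: nat
  shows "e < 2 \<Longrightarrow> (2 * q + e) div 2 = q" "e < 2 \<Longrightarrow> (2 * q + e) mod 2 = e"
    "e < 3 \<Longrightarrow> (3 * q + e) div 3 = q" "e < 3 \<Longrightarrow> (3 * q + e) mod 3 = e"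
  by simp_all

text \<open>
  A single chart suffices: forgetting the coordinates that vanish identically on the cell and
  sorting the others identifies it with an open subset of \<open>\<real>\<^bsup>2k\<^esup>\<close>.
\<close>

lemma block_cell_chart:
  assumes "k \<le> n"
    and \<tau>: "\<And>m. m < n \<Longrightarrow> \<tau> m < n" "\<And>m. m < n \<Longrightarrow> \<tau>' (\<tau> m) = m"
    and \<tau>': "\<And>m. m < n \<Longrightarrow> \<tau>' m < n" "\<And>m. m < n \<Longrightarrow> \<tau> (\<tau>' m) = m"
  shows "diffeomorphic (2*n) (block_cell n k \<tau>) (2*k) (block_domain (2*k) k (\<lambda>m. m))"
proof -
  let ?C = "block_cell n k \<tau>" and ?D = "block_domain (2*k) k (\<lambda>m. m)"
  define f :: "(nat \<Rightarrow> real) \<Rightarrow> nat \<Rightarrow> real" where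
    "f p j = (if j < 2*k then p (2 * \<tau> (j div 2) + j mod 2) else 0)" for p j
  define g :: "(nat \<Rightarrow> real) \<Rightarrow> nat \<Rightarrow> real" where
    "g w l = (if l < 2*n \<and> \<tau>' (l div 2) < k then w (2 * \<tau>' (l div 2) + l mod 2) else 0)" for w l
  have f: "f p (2 * m + e) = p (2 * \<tau> m + e)" if "m < k" "e < 2" for p m e
    using that by (simp add: f_def block_div_mod)
  have g: "g w (2 * \<tau> m + e) = (if m < k then w (2 * m + e) else 0)" if "m < n" "e < 2" for w m e
    using that \<tau>[of m] by (simp add: g_def block_div_mod)
  have zero: "p l = 0" if "p \<in> ?C" "2*n \<le> l" for p l
    using that by (simp add: block_cell_def block_domain_def topspace_Euclidean_space)
  have fC: "f ` ?C \<subseteq> ?D"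
  proof (intro image_subsetI)
    fix p assume p: "p \<in> ?C"
    have "f p (2 * m) \<noteq> 0 \<or> f p (2 * m + 1) \<noteq> 0" if "m < k" for m
      using p that f[OF that, of 0 p] f[OF that, of 1 p]
      by (simp add: block_cell_def block_domain_def)
    then show "f p \<in> ?D"
      by (simp add: block_domain_def topspace_Euclidean_space) (simp add: f_def)
  qed
  have gD: "g ` ?D \<subseteq> ?C"
  proof (intro image_subsetI)
    fix w assume w: "w \<in> ?D"
    have g0: "g w (2 * \<tau> m) = (if m < k then w (2 * m) else 0)"
      "g w (2 * \<tau> m + 1) = (if m < k then w (2 * m + 1) else 0)" if "m < n" for m
      using g[OF that, of 0 w] g[OF that, of 1 w] by simp_all
    have "g w \<in> topspace (Euclidean_space (2*n))"
      by (simp add: g_def topspace_Euclidean_space)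
    moreover have "g w (2 * \<tau> m) \<noteq> 0 \<or> g w (2 * \<tau> m + 1) \<noteq> 0" if "m < k" for m
      using g0[of m] w that \<open>k \<le> n\<close> by (simp add: block_domain_def)
    moreover have "g w (2 * \<tau> m) = 0 \<and> g w (2 * \<tau> m + 1) = 0" if "m \<in> {k..<n}" for m
      using g0[of m] that by simp
    ultimately show "g w \<in> ?C"
      unfolding block_cell_def block_domain_def by blast
  qed
  have gf: "g (f p) l = p l" if p: "p \<in> ?C" for p l
  proof (cases "l < 2*n")
    case True
    define m e where "m = \<tau>' (l div 2)" and "e = l mod 2"
    have m: "m < n" "\<tau> m = l div 2" and e: "e < 2"
      using True \<tau>'[of "l div 2"] by (simp_all add: m_def e_def)
    have l: "l = 2 * \<tau> m + e" by (simp add: m e_def)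
    show ?thesis
    proof (cases "m < k")
      case True
      show ?thesis unfolding l by (simp only: g[OF m(1) e] f[OF True e] True if_True)
    next
      case False
      then have "p (2 * \<tau> m) = 0 \<and> p (2 * \<tau> m + 1) = 0"
        using p m(1) by (simp add: block_cell_def)
      moreover have "e = 0 \<or> e = 1" using e by auto
      ultimately have "p (2 * \<tau> m + e) = 0" by auto
      with False show ?thesis unfolding l by (simp only: g[OF m(1) e] if_False)
    qed
  next
    case False
    then show ?thesis using zero[OF p] by (simp add: g_def)
  qed
  have fg: "f (g w) j = w j" if w: "w \<in> ?D" for w j
  proof (cases "j < 2*k")
    case True
    define m e where "m = j div 2" and "e = j mod 2"
    have m: "m < k" "e < 2" "j = 2 * m + e" using True by (auto simp: m_def e_def)
    then show ?thesis using \<open>k \<le> n\<close> by (simp add: f g)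
  next
    case False
    then show ?thesis using w by (simp add: f_def block_domain_def topspace_Euclidean_space)
  qed
  have subC: "?C \<subseteq> topspace (Euclidean_space (2*n))" and subD: "?D \<subseteq> topspace (Euclidean_space (2*k))"
    by (auto simp: block_cell_def block_domain_def)
  have "smooth_map (2*n) ?C (2*k) ?D f"
    by (rule elementary_on_smooth_map[OF openin_topspace subC subD fC])
      (simp add: f_def elementary_on.coord)
  moreover have "smooth_map (2*k) ?D (2*n) ?C g"
  proof (rule elementary_on_smooth_map[OF openin_topspace subD subC gD])
    show "(\<lambda>w. g w l) \<in> elementary_on (topspace (Euclidean_space (2*k)))" for l
      unfolding g_def by (intro elementary_on_if_zero elementary_on.coord)
  qed
  ultimately show ?thesis
    unfolding diffeomorphic_def using gf fg by blast
qed

lemma polar_coordinates: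
  fixes x y :: real
  assumes "x \<noteq> 0 \<or> y \<noteq> 0"
  defines "r \<equiv> x * x + y * y"
  shows "0 < r" "(x * r powr (-1/2))\<^sup>2 + (y * r powr (-1/2))\<^sup>2 = 1"
    "r powr (1/2) * (x * r powr (-1/2)) = x" "r powr (1/2) * (y * r powr (-1/2)) = y"
proof -
  show r: "0 < r"
    using assms(1) sum_squares_gt_zero_iff unfolding r_def by blast
  have s: "r powr (1/2) * r powr (-1/2) = 1"
    using r by (simp flip: powr_add)
  have s2: "(r powr (-1/2))\<^sup>2 * r = 1"
    using r by (simp add: power2_eq_square flip: powr_add)
  show "(x * r powr (-1/2))\<^sup>2 + (y * r powr (-1/2))\<^sup>2 = 1"
    using s2 by (simp add: r_def algebra_simps power2_eq_square)
  show "r powr (1/2) * (x * r powr (-1/2)) = x" "r powr (1/2) * (y * r powr (-1/2)) = y"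
    using s by (simp_all add: mult.left_commute[of "r powr (1/2)"])
qed

lemma polar_coordinates_inverse:
  fixes c s \<rho> :: real
  assumes cs: "c\<^sup>2 + s\<^sup>2 = 1" and \<rho>: "0 < \<rho>"
  defines "r \<equiv> (\<rho> * c) * (\<rho> * c) + (\<rho> * s) * (\<rho> * s)"
  shows "r powr (1/2) = \<rho>" "\<rho> * c * r powr (-1/2) = c" "\<rho> * s * r powr (-1/2) = s"
proof -
  have "r = \<rho>\<^sup>2 * (c\<^sup>2 + s\<^sup>2)"
    by (simp add: r_def algebra_simps power2_eq_square)
  then have r: "r = \<rho>\<^sup>2" using cs by simp
  show h: "r powr (1/2) = \<rho>"
    unfolding r using \<rho> by (simp add: powr_half_sqrt)
  have "r powr (-1/2) = 1 / \<rho>"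
    using powr_minus_divide[of r "1/2"] h by simp
  then show "\<rho> * c * r powr (-1/2) = c" "\<rho> * s * r powr (-1/2) = s"
    using \<rho> by simp_all
qed

text \<open>
  Each of the \<open>k\<close> punctured planes is a cylinder in polar coordinates: a point is sent to its
  direction on the circle and its radius, and the inverse map multiplies the two, so that it is
  polynomial and defined everywhere.
\<close>

lemma block_cell_cylinders:
  assumes "k \<le> n"
    and \<tau>: "\<And>m. m < n \<Longrightarrow> \<tau> m < n" "\<And>m. m < n \<Longrightarrow> \<tau>' (\<tau> m) = m"
    and \<tau>': "\<And>m. m < n \<Longrightarrow> \<tau>' m < n" "\<And>m. m < n \<Longrightarrow> \<tau> (\<tau>' m) = m"
  shows "diffeomorphic (2*n) (block_cell n k \<tau>) (3*k) (cylinders k)"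
proof -
  let ?C = "block_cell n k \<tau>" and ?U = "block_domain (2*n) k \<tau>" and ?D = "cylinders k"
  define r :: "(nat \<Rightarrow> real) \<Rightarrow> nat \<Rightarrow> real" where
    "r p m = p (2 * \<tau> m) * p (2 * \<tau> m) + p (2 * \<tau> m + 1) * p (2 * \<tau> m + 1)" for p m
  define f :: "(nat \<Rightarrow> real) \<Rightarrow> nat \<Rightarrow> real" where
    "f p j = (if j < 3*k then if j mod 3 = 2 then r p (j div 3) powr (1/2)
       else p (2 * \<tau> (j div 3) + j mod 3) * r p (j div 3) powr (-1/2) else 0)" for p j
  define g :: "(nat \<Rightarrow> real) \<Rightarrow> nat \<Rightarrow> real" where
    "g w l = (if l < 2*n \<and> \<tau>' (l div 2) < k
       then w (3 * \<tau>' (l div 2) + 2) * w (3 * \<tau>' (l div 2) + l mod 2) else 0)" for w l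
  have f: "f p (3 * m + e) = p (2 * \<tau> m + e) * r p m powr (-1/2)" if "m < k" "e < 2" for p m e
    using that block_div_mod(3,4)[of e m] by (simp add: f_def)
  have fr: "f p (3 * m + 2) = r p m powr (1/2)" if "m < k" for p m
    using that block_div_mod(3,4)[of 2 m] by (simp add: f_def)
  have g: "g w (2 * \<tau> m + e) = (if m < k then w (3 * m + 2) * w (3 * m + e) else 0)"
    if "m < n" "e < 2" for w m e
    using that \<tau>[of m] by (simp add: g_def block_div_mod)
  have g0: "g w (2 * \<tau> m) = (if m < k then w (3 * m + 2) * w (3 * m) else 0)"
    "g w (2 * \<tau> m + 1) = (if m < k then w (3 * m + 2) * w (3 * m + 1) else 0)" if "m < n" for w m
    using g[OF that, of 0 w] g[OF that, of 1 w] by simp_all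
  have nz: "p (2 * \<tau> m) \<noteq> 0 \<or> p (2 * \<tau> m + 1) \<noteq> 0" if "p \<in> ?U" "m < k" for p m
    using that by (simp add: block_domain_def)
  note polar = polar_coordinates[OF nz, folded r_def]
  have CU: "?C \<subseteq> ?U" by (auto simp: block_cell_def)
  have zero: "p l = 0" if "p \<in> ?C" "2*n \<le> l" for p l
    using that by (simp add: block_cell_def block_domain_def topspace_Euclidean_space)
  have cyl: "(w (3*m))\<^sup>2 + (w (3*m+1))\<^sup>2 = 1" "0 < w (3*m+2)" if "w \<in> ?D" "m < k" for w m
    using that by (simp_all add: cylinders_def)
  have fC: "f ` ?C \<subseteq> ?D"
  proof (intro image_subsetI)
    fix p assume "p \<in> ?C"
    then have p: "p \<in> ?U" using CU by blast
    have "(f p (3*m))\<^sup>2 + (f p (3*m+1))\<^sup>2 = 1 \<and> 0 < f p (3*m+2)" if "m < k" for m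
      using f[OF that, of 0 p] f[OF that, of 1 p] fr[OF that, of p] polar(1,2)[OF p that] by simp
    moreover have "f p \<in> topspace (Euclidean_space (3*k))"
      by (simp add: f_def topspace_Euclidean_space)
    ultimately show "f p \<in> ?D" unfolding cylinders_def by blast
  qed
  have gD: "g ` ?D \<subseteq> ?C"
  proof (intro image_subsetI)
    fix w assume w: "w \<in> ?D"
    have "g w \<in> topspace (Euclidean_space (2*n))"
      by (simp add: g_def topspace_Euclidean_space)
    moreover have "g w (2 * \<tau> m) \<noteq> 0 \<or> g w (2 * \<tau> m + 1) \<noteq> 0" if "m < k" for m
    proof -
      have "w (3*m) \<noteq> 0 \<or> w (3*m+1) \<noteq> 0" using cyl(1)[OF w that] by auto
      then show ?thesis
        using g0[of m w] cyl(2)[OF w that] that \<open>k \<le> n\<close> by simp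
    qed
    moreover have "g w (2 * \<tau> m) = 0 \<and> g w (2 * \<tau> m + 1) = 0" if "m \<in> {k..<n}" for m
      using g0[of m w] that by simp
    ultimately show "g w \<in> ?C"
      unfolding block_cell_def block_domain_def by blast
  qed
  have gf: "g (f p) l = p l" if p: "p \<in> ?C" for p l
  proof (cases "l < 2*n")
    case True
    define m e where "m = \<tau>' (l div 2)" and "e = l mod 2"
    have m: "m < n" "\<tau> m = l div 2" and e: "e < 2"
      using True \<tau>'[of "l div 2"] by (simp_all add: m_def e_def)
    have l: "l = 2 * \<tau> m + e" by (simp add: m e_def)
    have e01: "e = 0 \<or> e = 1" using e by auto
    show ?thesis
    proof (cases "m < k")
      case True
      then have "g (f p) l = r p m powr (1/2) * (p (2 * \<tau> m + e) * r p m powr (-1/2))"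
        unfolding l by (simp only: g[OF m(1) e] f[OF True e] fr[OF True] if_True)
      also have "\<dots> = p (2 * \<tau> m + e)"
        using polar(3,4)[OF subsetD[OF CU p] True] e01 by auto
      finally show ?thesis unfolding l .
    next
      case False
      then have "p (2 * \<tau> m) = 0 \<and> p (2 * \<tau> m + 1) = 0"
        using p m(1) by (simp add: block_cell_def)
      then have "p (2 * \<tau> m + e) = 0" using e01 by auto
      with False show ?thesis unfolding l by (simp only: g[OF m(1) e] if_False)
    qed
  next
    case False
    then show ?thesis using zero[OF p] by (simp add: g_def)
  qed
  have fg: "f (g w) j = w j" if w: "w \<in> ?D" for w j
  proof (cases "j < 3*k")
    case True
    define m e where "m = j div 3" and "e = j mod 3"
    have m: "m < k" "j = 3 * m + e" and "e < 3" using True by (auto simp: m_def e_def)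
    then have e: "e = 0 \<or> e = 1 \<or> e = 2" by auto
    have mn: "m < n" using m \<open>k \<le> n\<close> by simp
    have "r (g w) m = (w (3*m+2) * w (3*m)) * (w (3*m+2) * w (3*m))
        + (w (3*m+2) * w (3*m+1)) * (w (3*m+2) * w (3*m+1))"
      unfolding r_def g0[OF mn] using m by simp
    note inv = polar_coordinates_inverse[OF cyl[OF w m(1)], folded this]
    have "f (g w) (3*m) = w (3*m)" "f (g w) (3*m+1) = w (3*m+1)" "f (g w) (3*m+2) = w (3*m+2)"
      using f[OF m(1), of 0 "g w"] f[OF m(1), of 1 "g w"] fr[OF m(1), of "g w"] g0[OF mn, of w] inv m(1)
      by simp_all
    then show ?thesis using e m(2) by auto
  next
    case False
    then show ?thesis using w by (simp add: f_def cylinders_def topspace_Euclidean_space)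
  qed
  have subC: "?C \<subseteq> topspace (Euclidean_space (2*n))" and subD: "?D \<subseteq> topspace (Euclidean_space (3*k))"
    by (auto simp: block_cell_def block_domain_def cylinders_def)
  have "smooth_map (2*n) ?C (3*k) ?D f"
  proof (rule elementary_on_smooth_map[OF openin_block_domain CU subD fC])
    fix j assume j: "j < 3*k"
    then have m: "j div 3 < k" by auto
    have r: "(\<lambda>p. r p (j div 3)) \<in> elementary_on ?U"
      unfolding r_def by (intro elementary_on.add elementary_on.mult elementary_on.coord)
    have "(\<lambda>p. r p (j div 3) powr a) \<in> elementary_on ?U" for a
      by (rule elementary_on.powr[OF r polar(1)[OF _ m]])
    then show "(\<lambda>p. f p j) \<in> elementary_on ?U"
      using j by (cases "j mod 3 = 2") (simp_all add: f_def elementary_on.mult elementary_on.coord)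
  qed
  moreover have "smooth_map (3*k) ?D (2*n) ?C g"
  proof (rule elementary_on_smooth_map[OF openin_topspace subD subC gD])
    show "(\<lambda>w. g w l) \<in> elementary_on (topspace (Euclidean_space (3*k)))" for l
      unfolding g_def by (intro elementary_on_if_zero elementary_on.mult elementary_on.coord)
  qed
  ultimately show ?thesis
    unfolding diffeomorphic_def using gf fg by blast
qed

section \<open>The cell decomposition\<close>

lemma cell_charts:
  assumes \<sigma>: "\<sigma> permutes {1..n}" and k: "k \<le> n"
  shows "diffeomorphic (2*n) (cell n k \<sigma>) (2*k) (block_domain (2*k) k (\<lambda>m. m))"
    and "diffeomorphic (2*n) (cell n k \<sigma>) (3*k) (cylinders k)"
proof -
  define \<tau> \<tau>' where "\<tau> m = \<sigma> (Suc m) - 1" and "\<tau>' m = inv_into UNIV \<sigma> (Suc m) - 1" for m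
  have range: "\<rho> (Suc m) \<in> {1..n}" if "\<rho> permutes {1..n}" "m < n" for \<rho> m
    using that(2) permutes_in_image[OF that(1), of "Suc m"] by simp
  have \<tau>: "\<tau> m < n" "Suc (\<tau> m) = \<sigma> (Suc m)" if "m < n" for m
    using range[OF \<sigma> that] by (auto simp: \<tau>_def)
  have \<tau>': "\<tau>' m < n" "Suc (\<tau>' m) = inv_into UNIV \<sigma> (Suc m)" if "m < n" for m
    using range[OF permutes_inv[OF \<sigma>] that] by (auto simp: \<tau>'_def)
  have "\<tau>' (\<tau> m) = m" "\<tau> (\<tau>' m) = m" if "m < n" for m
    using \<tau>(2)[OF that] \<tau>'(2)[OF that] permutes_inverses[OF \<sigma>]
    by (simp_all add: \<tau>_def[of "\<tau>' m"] \<tau>'_def[of "\<tau> m"])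
  note * = k \<tau>(1) this(1) \<tau>'(1) this(2)
  show "diffeomorphic (2*n) (cell n k \<sigma>) (2*k) (block_domain (2*k) k (\<lambda>m. m))"
    and "diffeomorphic (2*n) (cell n k \<sigma>) (3*k) (cylinders k)"
    unfolding cell_eq_block_cell[OF \<sigma> k] \<tau>_def[symmetric, abs_def]
    using block_cell_chart[of k n \<tau> \<tau>'] block_cell_cylinders[of k n \<tau> \<tau>'] * by blast+
qed

lemma manifold_cell:
  assumes \<sigma>: "\<sigma> permutes {1..n}" and k: "k \<le> n"
  shows "manifold (2*n) (2*k) (cell n k \<sigma>)"
  unfolding manifold_def
proof (intro conjI ballI)
  show sub: "cell n k \<sigma> \<subseteq> topspace (Euclidean_space (2*n))"
    by (auto simp: cell_def topspace_Euclidean_space)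
  show "\<exists>W V. x \<in> W \<and> openin (subtopology (Euclidean_space (2*n)) (cell n k \<sigma>)) W \<and>
      openin (Euclidean_space (2*k)) V \<and> diffeomorphic (2*n) W (2*k) V" if "x \<in> cell n k \<sigma>" for x
  proof (intro exI conjI)
    show "x \<in> cell n k \<sigma>" by fact
    show "openin (subtopology (Euclidean_space (2*n)) (cell n k \<sigma>)) (cell n k \<sigma>)"
      unfolding subtopology_Euclidean_space[OF sub] by simp
  qed (rule openin_block_domain cell_charts(1)[OF \<sigma> k])+
qed

text \<open>
  The dimension of a cell is unique because cells are nonempty and \<open>manifold_dim_le\<close> applies in
  both directions.
\<close>

lemma manifold_cell_iff:
  assumes \<sigma>: "\<sigma> permutes {1..n}" and k: "k \<le> n"
  shows "manifold (2*n) d (cell n k \<sigma>) \<longleftrightarrow> d = 2*k"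
proof
  assume d: "manifold (2*n) d (cell n k \<sigma>)"
  obtain x :: "nat \<Rightarrow> real" where x: "x \<in> cell n k \<sigma>"
    using stratum_nonempty unfolding cell_eq_stratum[OF \<sigma> k] by blast
  show "d = 2*k"
    using manifold_dim_le[OF d x manifold_cell[OF \<sigma> k]]
      manifold_dim_le[OF manifold_cell[OF \<sigma> k] x d] by simp
qed (simp add: manifold_cell[OF \<sigma> k])

lemma cell_perms_disjoint:
  assumes \<sigma>: "\<sigma> \<in> perms n k" "k \<le> n" and \<tau>: "\<tau> \<in> perms n j" "j \<le> n"
    and ne: "(k, \<sigma>) \<noteq> (j, \<tau>)"
  shows "cell n k \<sigma> \<inter> cell n j \<tau> = {}"
proof -
  let ?S = "\<sigma> ` {1..k}" and ?T = "\<tau> ` {1..j}"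
  have S: "?S \<subseteq> {1..n}" "card ?S = k"
    using bij_betwE[OF perms_bij_subsets[OF \<sigma>(2)]] \<sigma>(1) by simp_all
  have T: "?T \<subseteq> {1..n}" "card ?T = j"
    using bij_betwE[OF perms_bij_subsets[OF \<tau>(2)]] \<tau>(1) by simp_all
  have "?S \<noteq> ?T"
  proof
    assume eq: "?S = ?T"
    then have "k = j" using S(2) T(2) by simp
    moreover have "\<sigma> = \<tau>"
      using perms_determined_by_image[OF \<sigma>(1) _ \<sigma>(2)] \<tau>(1) eq unfolding \<open>k = j\<close> by blast
    ultimately show False using ne by simp
  qed
  with S(1) T(1) show ?thesis
    unfolding cell_eq_stratum[OF permsD(1)[OF \<sigma>(1)] \<sigma>(2)] cell_eq_stratum[OF permsD(1)[OF \<tau>(1)] \<tau>(2)]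
    by (rule stratum_disjoint)
qed

lemma cells_cover:
  "topspace (Euclidean_space (2*n)) = (\<Union>k\<in>{0..n}. \<Union>\<sigma>\<in>perms n k. cell n k \<sigma>)" (is "?L = ?R")
proof
  show "?R \<subseteq> ?L" by (auto simp: cell_def topspace_Euclidean_space)
  show "?L \<subseteq> ?R"
  proof
    fix p :: "nat \<Rightarrow> real" assume p: "p \<in> ?L"
    define S where "S = {i\<in>{1..n}. (xc i p, yc i p) \<noteq> (0, 0)}"
    define k where "k = card S"
    have S: "S \<subseteq> {1..n}" by (auto simp: S_def)
    have k: "k \<le> n" using card_mono[OF _ S] by (simp add: k_def)
    obtain \<sigma> where \<sigma>: "\<sigma> \<in> perms n k" "\<sigma> ` {1..k} = S"
      using perms_image_surj[OF S k_def[symmetric]] by blast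
    have "p \<in> stratum n S"
      using p unfolding stratum_def S_def topspace_Euclidean_space by blast
    then have "p \<in> cell n k \<sigma>"
      unfolding cell_eq_stratum[OF permsD(1)[OF \<sigma>(1)] k] \<sigma>(2) .
    with \<sigma>(1) k show "p \<in> ?R" by auto
  qed
qed

lemma cell_0: "cell n 0 id = {\<lambda>_. 0}"
proof (intro equalityI subsetI)
  fix p :: "nat \<Rightarrow> 'a" assume p: "p \<in> cell n 0 id"
  have "p l = 0" for l
  proof (cases "l < 2*n")
    case True
    define i where "i = l div 2 + 1"
    have "i \<in> {0<..n}" using True by (auto simp: i_def)
    then have "p (2*i - 2) = 0" "p (2*i - 1) = 0"
      using p unfolding cell_def xc_def yc_def by auto
    moreover have "l = 2*i - 2 \<or> l = 2*i - 1" unfolding i_def by presburger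
    ultimately show ?thesis by metis
  qed (use p in \<open>simp add: cell_def\<close>)
  then show "p \<in> {\<lambda>_. 0}" by auto
qed (auto simp: cell_def xc_def yc_def)

theorem lemma2p2:
  fixes n :: nat
  assumes "n \<ge> 1"
  defines "cells \<equiv> (\<Union>k\<in>{0..n}. cell n k ` perms n k) :: (nat \<Rightarrow> real) set set"
  shows
    "disjoint_family_on (\<lambda>(k, \<sigma>). cell n k \<sigma> :: (nat \<Rightarrow> real) set) (SIGMA k:{0..n}. perms n k) \<and>
     topspace (Euclidean_space (2*n)) = (\<Union>k\<in>{0..n}. \<Union>\<sigma>\<in>perms n k. cell n k \<sigma>) \<and>
     perms n 0 = {id} \<and> cell n 0 id = {\<lambda>_. 0 :: real} \<and>
     (\<forall>k\<in>{0..n}. \<forall>\<sigma>\<in>perms n k.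
        manifold (2*n) (2*k) (cell n k \<sigma>) \<and>
        eulerian_flow_invariant n (cell n k \<sigma>) \<and>
        formal_eulerian_flow_invariant n (cell n k \<sigma>) \<and>
        diffeomorphic (2*n) (cell n k \<sigma>) (3*k) (cylinders k)) \<and>
     (\<forall>k\<in>{1..n}.
        bij_betw (cell n k) (perms n k) {M \<in> cells. manifold (2*n) (2*k) M} \<and>
        card {M \<in> cells. manifold (2*n) (2*k) M} = n choose k) \<and>
     (\<forall>M\<in>cells. \<forall>d. odd d \<longrightarrow> \<not> manifold (2*n) d M)"
proof (intro conjI)
  show "disjoint_family_on (\<lambda>(k, \<sigma>). cell n k \<sigma> :: (nat \<Rightarrow> real) set) (SIGMA k:{0..n}. perms n k)"
    unfolding disjoint_family_on_def
  proof (intro ballI impI)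
    fix a b
    assume ab: "a \<in> (SIGMA k:{0..n}. perms n k)" "b \<in> (SIGMA k:{0..n}. perms n k)" "a \<noteq> b"
    obtain k \<sigma> j \<tau> where eq: "a = (k, \<sigma>)" "b = (j, \<tau>)"
      by (cases a, cases b)
    show "(\<lambda>(k, \<sigma>). cell n k \<sigma> :: (nat \<Rightarrow> real) set) a \<inter> (\<lambda>(k, \<sigma>). cell n k \<sigma>) b = {}"
      using cell_perms_disjoint[of \<sigma> n k \<tau> j] ab unfolding eq by simp
  qed
  show "topspace (Euclidean_space (2*n)) = (\<Union>k\<in>{0..n}. \<Union>\<sigma>\<in>perms n k. cell n k \<sigma>)"
    by (rule cells_cover)
  show "perms n 0 = {id}" by (rule perms_0)
  show "cell n 0 id = {\<lambda>_. 0 :: real}"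
    by (rule cell_0)
  have M: "manifold (2*n) d (cell n k \<sigma>) \<longleftrightarrow> d = 2*k" if "k \<in> {0..n}" "\<sigma> \<in> perms n k" for d k \<sigma>
    using manifold_cell_iff[OF permsD(1)[OF that(2)]] that(1) by simp
  show "\<forall>k\<in>{0..n}. \<forall>\<sigma>\<in>perms n k.
        manifold (2*n) (2*k) (cell n k \<sigma>) \<and>
        eulerian_flow_invariant n (cell n k \<sigma>) \<and>
        formal_eulerian_flow_invariant n (cell n k \<sigma>) \<and>
        diffeomorphic (2*n) (cell n k \<sigma>) (3*k) (cylinders k)"
  proof (intro ballI)
    fix k \<sigma> assume k: "k \<in> {0..n}" and \<sigma>: "\<sigma> \<in> perms n k"
    from k have kn: "k \<le> n" by simp
    note p = permsD(1)[OF \<sigma>] kn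
    show "manifold (2*n) (2*k) (cell n k \<sigma>) \<and>
        eulerian_flow_invariant n (cell n k \<sigma>) \<and>
        formal_eulerian_flow_invariant n (cell n k \<sigma>) \<and>
        diffeomorphic (2*n) (cell n k \<sigma>) (3*k) (cylinders k)"
      using manifold_cell[OF p] cell_eulerian_flow_invariant[OF p]
        cell_formal_eulerian_flow_invariant[OF p] cell_charts(2)[OF p] by blast
  qed
  have bij: "bij_betw (cell n k) (perms n k) {M \<in> cells. manifold (2*n) (2*k) M}" if k: "k \<in> {1..n}" for k
    unfolding bij_betw_def
  proof (intro conjI inj_onI equalityI subsetI)
    from k have kn: "k \<le> n" by simp
    fix \<sigma> \<tau> assume st: "\<sigma> \<in> perms n k" "\<tau> \<in> perms n k"
      and eq: "(cell n k \<sigma> :: (nat \<Rightarrow> real) set) = cell n k \<tau>"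
    show "\<sigma> = \<tau>"
    proof (rule ccontr)
      assume "\<sigma> \<noteq> \<tau>"
      then have "cell n k \<sigma> \<inter> cell n k \<tau> = ({} :: (nat \<Rightarrow> real) set)"
        by (intro cell_perms_disjoint st kn) simp
      then show False
        using eq stratum_nonempty unfolding cell_eq_stratum[OF permsD(1)[OF st(1)] kn] by simp
    qed
  next
    fix N :: "(nat \<Rightarrow> real) set" assume "N \<in> cell n k ` perms n k"
    then obtain \<sigma> where "\<sigma> \<in> perms n k" "N = cell n k \<sigma>" by blast
    moreover have "k \<in> {0..n}" using k by simp
    ultimately show "N \<in> {M \<in> cells. manifold (2*n) (2*k) M}"
      using M[of k \<sigma> "2*k"] unfolding cells_def by blast
  next
    fix N assume N: "N \<in> {M \<in> cells. manifold (2*n) (2*k) M}"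
    then obtain j \<sigma> where j: "j \<in> {0..n}" "\<sigma> \<in> perms n j" "N = cell n j \<sigma>"
      unfolding cells_def by blast
    with N M[OF j(1,2), of "2*k"] have "j = k" by simp
    with j(2,3) show "N \<in> cell n k ` perms n k" by blast
  qed
  show "\<forall>k\<in>{1..n}.
        bij_betw (cell n k) (perms n k) {M \<in> cells. manifold (2*n) (2*k) M} \<and>
        card {M \<in> cells. manifold (2*n) (2*k) M} = n choose k"
  proof (intro ballI conjI)
    fix k assume k: "k \<in> {1..n}"
    show "bij_betw (cell n k) (perms n k) {M \<in> cells. manifold (2*n) (2*k) M}" using k by (rule bij)
    show "card {M \<in> cells. manifold (2*n) (2*k) M} = n choose k"
      using bij_betw_same_card[OF bij[OF k]] card_perms[of k n] k by simp
  qed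
  show "\<forall>M\<in>cells. \<forall>d. odd d \<longrightarrow> \<not> manifold (2*n) d M"
  proof (intro ballI allI impI notI)
    fix N d assume "N \<in> cells" and d: "odd d" "manifold (2*n) d N"
    then obtain j \<sigma> where j: "j \<in> {0..n}" "\<sigma> \<in> perms n j" "N = cell n j \<sigma>"
      unfolding cells_def by blast
    with M[OF j(1,2), of d] d show False by simp
  qed
qed

end
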